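(* Let $G$ be a finite simple graph and $S\subseteq V(G)$. If $|S|\ge |V(G)|-3$, then $J(G\cup W(S))^{(k)}$ is a componentwise linear ideal for all $k\ge 1$.
   Context: For $S\subseteq V(G)$, $G\cup W(S)$ is the graph with vertex set $V(G)\cup\{z_x : x\in S\}$ (the $z_x$ being new distinct vertices) and edge set $E(G)\cup\{\{x,z_x\}: x\in S\}$. For a graph $H$ with vertex set $\{x_1,\dots,x_n\}$, in $R=\mathbb{K}[x_1,\dots,x_n]$, $\mathbb{K}$ a field, the cover ideal is $J(H)=\bigcap_{\{x_i,x_j\}\in E(H)}(x_i,x_j)$, and its $k$-th symbolic power is $J(H)^{(k)}=\bigcap_{\{x_i,x_j\}\in E(H)}(x_i,x_j)^k$. A homogeneous ideal $I$ is componentwise linear if for each $\ell$ the ideal generated by all degree $\ell$ elements of $I$ has a linear resolution. *)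

theory Defs
  imports "HOL-Library.Poly_Mapping" "HOL-Algebra.Ideal_Product"
begin

section \<open>Graphs and whiskers\<close>

definition simple_graph :: "'v set \<Rightarrow> 'v set set \<Rightarrow> bool" where
  "simple_graph V E \<longleftrightarrow> finite V \<and> (\<forall>e\<in>E. e \<subseteq> V \<and> card e = 2)"

text \<open>The graph with a whisker attached at every vertex of \<open>S\<close>: the old vertices \<open>x\<close> are
  represented by \<open>Inl x\<close>, and the new vertices \<open>z_x\<close> by \<open>Inr x\<close>.\<close>

definition whisker_verts :: "'v set \<Rightarrow> 'v set \<Rightarrow> ('v + 'v) set" where
  "whisker_verts V S = Inl ` V \<union> Inr ` S"

definition whisker_edges :: "'v set set \<Rightarrow> 'v set \<Rightarrow> ('v + 'v) set set" where
  "whisker_edges E S = (image Inl) ` E \<union> {{Inl x, Inr x} | x. x \<in> S}"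

lemma simple_graph_whisker:
  assumes "simple_graph V E" "S \<subseteq> V"
  shows "simple_graph (whisker_verts V S) (whisker_edges E S)"
  using assms finite_subset[OF assms(2)]
  by (auto simp: simple_graph_def whisker_verts_def whisker_edges_def card_image)


section \<open>Polynomial rings\<close>

text \<open>A monomial is a finitely supported exponent vector, a polynomial a finitely supported
  family of coefficients indexed by monomials. The type provides all elements of \<open>'v\<close> as
  variables; the ring \<open>K[X]\<close> in the variables \<open>X\<close> is a carrier inside it.\<close>

type_synonym ('v, 'k) mpoly = "('v \<Rightarrow>\<^sub>0 nat) \<Rightarrow>\<^sub>0 'k"

definition poly_ring :: "'v set \<Rightarrow> ('v, 'k::field) mpoly ring" where
  "poly_ring X = \<lparr>carrier = {p. \<forall>m\<in>Poly_Mapping.keys p. Poly_Mapping.keys m \<subseteq> X},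
                  mult = (*), one = 1, zero = 0, add = (+)\<rparr>"

definition var :: "'v \<Rightarrow> ('v, 'k::field) mpoly" where
  "var x = Poly_Mapping.single (Poly_Mapping.single x 1) 1"

definition mdeg :: "('v \<Rightarrow>\<^sub>0 nat) \<Rightarrow> nat" where
  "mdeg m = (\<Sum>x\<in>Poly_Mapping.keys m. Poly_Mapping.lookup m x)"

text \<open>The zero polynomial is homogeneous of every degree.\<close>

definition homogeneous :: "nat \<Rightarrow> ('v, 'k::field) mpoly \<Rightarrow> bool" where
  "homogeneous d p \<longleftrightarrow> (\<forall>m\<in>Poly_Mapping.keys p. mdeg m = d)"

definition homogeneous_ideal :: "'v set \<Rightarrow> ('v, 'k::field) mpoly set \<Rightarrow> bool" where
  "homogeneous_ideal X I \<longleftrightarrow>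
     ideal I (poly_ring X) \<and> I = Idl\<^bsub>poly_ring X\<^esub> {f \<in> I. \<exists>d. homogeneous d f}"

lemma poly_ring_simps [simp]:
  "mult (poly_ring X) = (*)" "one (poly_ring X) = 1"
  "zero (poly_ring X) = 0" "add (poly_ring X) = (+)"
  by (simp_all add: poly_ring_def)

lemma in_poly_ring_iff:
  "p \<in> carrier (poly_ring X) \<longleftrightarrow> (\<forall>m\<in>Poly_Mapping.keys p. Poly_Mapping.keys m \<subseteq> X)"
  by (simp add: poly_ring_def)

lemma var_in_poly_ring: "x \<in> X \<Longrightarrow> var x \<in> carrier (poly_ring X)"
  by (simp add: in_poly_ring_iff var_def)

lemma cring_poly_ring: "cring (poly_ring X :: ('v, 'k::field) mpoly ring)"
proof (rule cringI)
  let ?R = "poly_ring X :: ('v, 'k) mpoly ring"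
  have add: "p + q \<in> carrier ?R" if "p \<in> carrier ?R" "q \<in> carrier ?R" for p q
    using that Poly_Mapping.keys_add[of p q] by (auto simp: in_poly_ring_iff)
  have mult: "p * q \<in> carrier ?R" if "p \<in> carrier ?R" "q \<in> carrier ?R" for p q
  proof -
    have "Poly_Mapping.keys m \<subseteq> X" if m: "m \<in> Poly_Mapping.keys (p * q)" for m
    proof -
      obtain a b where "m = a + b" "a \<in> Poly_Mapping.keys p" "b \<in> Poly_Mapping.keys q"
        using keys_mult[of p q] m by auto
      with \<open>p \<in> carrier ?R\<close> \<open>q \<in> carrier ?R\<close> Poly_Mapping.keys_add[of a b]
      show ?thesis by (fastforce simp: in_poly_ring_iff)
    qed
    then show ?thesis by (simp add: in_poly_ring_iff)
  qed
  show "abelian_group ?R"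
  proof (rule abelian_groupI)
    fix p assume "p \<in> carrier ?R"
    then show "\<exists>q\<in>carrier ?R. q \<oplus>\<^bsub>?R\<^esub> p = \<zero>\<^bsub>?R\<^esub>"
      by (intro bexI[of _ "- p"]) (auto simp: in_poly_ring_iff)
  qed (auto simp: add add.assoc add.commute in_poly_ring_iff[of 0])
  show "comm_monoid ?R"
    by (rule comm_monoidI)
      (auto simp: mult mult.assoc mult.commute in_poly_ring_iff[of 1])
qed (auto simp: algebra_simps)


section \<open>Cover ideals and their symbolic powers\<close>

text \<open>Intersecting with the carrier makes the intersection over the empty edge set the whole
  ring. The power of an ideal is the one in the monoid of ideals.\<close>

definition cover_ideal :: "'v set \<Rightarrow> 'v set set \<Rightarrow> ('v, 'k::field) mpoly set" where
  "cover_ideal V E = carrier (poly_ring V) \<inter> (\<Inter>e\<in>E. Idl\<^bsub>poly_ring V\<^esub> (var ` e))"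

definition cover_symbolic_power ::
    "'v set \<Rightarrow> 'v set set \<Rightarrow> nat \<Rightarrow> ('v, 'k::field) mpoly set" where
  "cover_symbolic_power V E k = carrier (poly_ring V) \<inter>
     (\<Inter>e\<in>E. (Idl\<^bsub>poly_ring V\<^esub> (var ` e)) [^]\<^bsub>ideals_set (poly_ring V)\<^esub> k)"

lemma cover_symbolic_power_1:
  assumes "simple_graph V E"
  shows "cover_symbolic_power V E 1 = (cover_ideal V E :: ('v, 'k::field) mpoly set)"
proof -
  let ?R = "poly_ring V :: ('v, 'k) mpoly ring"
  interpret cring ?R by (rule cring_poly_ring)
  have "(Idl\<^bsub>?R\<^esub> (var ` e)) [^]\<^bsub>ideals_set ?R\<^esub> (1::nat) = Idl\<^bsub>?R\<^esub> (var ` e)" if "e \<in> E" for e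
  proof -
    have "var ` e \<subseteq> carrier ?R"
      using that assms by (auto simp: simple_graph_def intro!: var_in_poly_ring)
    then have I: "ideal (Idl\<^bsub>?R\<^esub> (var ` e)) ?R" by (rule genideal_ideal)
    have "carrier ?R \<cdot>\<^bsub>?R\<^esub> (Idl\<^bsub>?R\<^esub> (var ` e)) = Idl\<^bsub>?R\<^esub> (var ` e)"
      using ideal_prod_one[OF I] ideal_prod_commute[OF I oneideal] by simp
    then show ?thesis
      by (simp add: nat_pow_def ideals_set_def)
  qed
  then show ?thesis
    by (simp add: cover_symbolic_power_def cover_ideal_def)
qed


section \<open>Graded free resolutions\<close>

definition free_mod :: "'v set \<Rightarrow> nat \<Rightarrow> (nat \<Rightarrow> ('v, 'k::field) mpoly) set" where
  "free_mod X n = {u. (\<forall>i<n. u i \<in> carrier (poly_ring X)) \<and> (\<forall>i\<ge>n. u i = 0)}"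

definition row_app ::
    "nat \<Rightarrow> (nat \<Rightarrow> ('v, 'k::field) mpoly) \<Rightarrow> (nat \<Rightarrow> ('v, 'k) mpoly) \<Rightarrow> ('v, 'k) mpoly" where
  "row_app n g u = (\<Sum>c<n. g c * u c)"

definition mat_app ::
    "nat \<Rightarrow> nat \<Rightarrow> (nat \<Rightarrow> nat \<Rightarrow> ('v, 'k::field) mpoly) \<Rightarrow> (nat \<Rightarrow> ('v, 'k) mpoly)
      \<Rightarrow> (nat \<Rightarrow> ('v, 'k) mpoly)" where
  "mat_app m n A u = (\<lambda>r. if r < m then row_app n (A r) u else 0)"

text \<open>\<open>\<dots> \<longrightarrow> F 2 \<longrightarrow> F 1 \<longrightarrow> F 0 \<longrightarrow> I \<longrightarrow> 0\<close> is a resolution by the graded free modules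
  \<open>F i = (\<Oplus>j<b i. R(- a i j))\<close>, with \<open>R = K[X]\<close>. The augmentation \<open>F 0 \<longrightarrow> I\<close> is given by the row
  \<open>g\<close>, and \<open>F (i + 1) \<longrightarrow> F i\<close> by the \<open>b i \<times> b (i + 1)\<close> matrix \<open>D i\<close>. The maps are homogeneous of
  degree 0: the entry \<open>D i r c\<close> is homogeneous of degree \<open>a (i + 1) c - a i r\<close>, and is 0 if that
  number is negative.\<close>

definition graded_free_resolution ::
    "'v set \<Rightarrow> ('v, 'k::field) mpoly set \<Rightarrow> (nat \<Rightarrow> nat) \<Rightarrow> (nat \<Rightarrow> nat \<Rightarrow> nat)
      \<Rightarrow> (nat \<Rightarrow> ('v, 'k) mpoly) \<Rightarrow> (nat \<Rightarrow> nat \<Rightarrow> nat \<Rightarrow> ('v, 'k) mpoly) \<Rightarrow> bool" where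
  "graded_free_resolution X I b a g D \<longleftrightarrow>
     (\<forall>c<b 0. g c \<in> carrier (poly_ring X) \<and> homogeneous (a 0 c) (g c)) \<and>
     (\<forall>i. \<forall>r<b i. \<forall>c<b (Suc i). D i r c \<in> carrier (poly_ring X) \<and>
        (\<forall>m\<in>Poly_Mapping.keys (D i r c). mdeg m + a i r = a (Suc i) c)) \<and>
     row_app (b 0) g ` free_mod X (b 0) = I \<and>
     mat_app (b 0) (b 1) (D 0) ` free_mod X (b 1) =
        {u \<in> free_mod X (b 0). row_app (b 0) g u = 0} \<and>
     (\<forall>i. mat_app (b (Suc i)) (b (Suc (Suc i))) (D (Suc i)) ` free_mod X (b (Suc (Suc i))) =
        {u \<in> free_mod X (b (Suc i)). mat_app (b i) (b (Suc i)) (D i) u = (\<lambda>_. 0)})"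

text \<open>Minimality: every map \<open>F (i + 1) \<longrightarrow> F i\<close> has its image in \<open>\<mm> F i\<close>, i.e.\ the entries of the
  matrices have constant coefficient 0.\<close>

definition minimal_graded_free_resolution ::
    "'v set \<Rightarrow> ('v, 'k::field) mpoly set \<Rightarrow> (nat \<Rightarrow> nat) \<Rightarrow> (nat \<Rightarrow> nat \<Rightarrow> nat)
      \<Rightarrow> (nat \<Rightarrow> ('v, 'k) mpoly) \<Rightarrow> (nat \<Rightarrow> nat \<Rightarrow> nat \<Rightarrow> ('v, 'k) mpoly) \<Rightarrow> bool" where
  "minimal_graded_free_resolution X I b a g D \<longleftrightarrow>
     graded_free_resolution X I b a g D \<and>
     (\<forall>i. \<forall>r<b i. \<forall>c<b (Suc i). Poly_Mapping.lookup (D i r c) 0 = 0)"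

text \<open>The minimal graded free resolution is unique up to isomorphism, so it is linear as soon as
  some minimal one is: \<open>F i = R(- d - i)^(b i)\<close> for a fixed \<open>d\<close>. The zero ideal, whose
  minimal resolution is 0, has a linear resolution.\<close>

definition has_linear_resolution :: "'v set \<Rightarrow> ('v, 'k::field) mpoly set \<Rightarrow> bool" where
  "has_linear_resolution X I \<longleftrightarrow>
     (\<exists>d b a g D. minimal_graded_free_resolution X I b a g D \<and> (\<forall>i. \<forall>j<b i. a i j = d + i))"

definition componentwise_linear :: "'v set \<Rightarrow> ('v, 'k::field) mpoly set \<Rightarrow> bool" where
  "componentwise_linear X I \<longleftrightarrow> homogeneous_ideal X I \<and>
     (\<forall>l. has_linear_resolution X (Idl\<^bsub>poly_ring X\<^esub> {f \<in> I. homogeneous l f}))"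

end

theory Submission
  imports Defs
begin

text \<open>The symbolic power is the monomial ideal of the exponent vectors \<open>m\<close> with \<open>m u + m v \<ge> k\<close> on
  every edge. For each \<open>l\<close>, its monomials of degree \<open>l\<close>, ordered lexicographically with the
  variables of \<open>V - S\<close> first, then those of \<open>S\<close>, then the whisker variables, have linear quotients.
  An ideal with linear quotients is built up by extensions whose colon ideals are generated by
  variables, so the horseshoe lemma, applied to all syzygy modules simultaneously by coinduction,
  provides a linear resolution.\<close>

section \<open>Polynomial rings and homogeneous components\<close>

text \<open>Linear quotients turn linearity into an exchange property. For monomials a, b of equal
  degree with b listed first, it suffices to find variables x_i, x_j, with x_j earlier than x_i,
  such that x_j has a smaller exponent in a than in b and x_j a / x_i still satisfies all edge
  constraints. Such an exchange fails only at a tight constraint through x_i. A whisker variable can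
  be traded for its own vertex without changing the total on that whisker, which is why whisker
  variables come last and why the real difficulty sits in V - S. The bound 3 arises there: a failure
  produces a vertex t where b is first ahead, a vertex i where b is behind, and a neighbour w of i
  on a tight edge. If these three exhaust V - S, comparing totals gives a contradiction; a further
  vertex would be free to absorb the difference. A resolution is an infinite sequence of matrices,
  so no bound on its length is needed: coinduction supplies the next matrix forever. Minimality
  comes for free, because all matrix entries are linear forms. Only exponents matter, so the field
  is arbitrary.\<close>

lemma poly_ring_zero: "0 \<in> carrier (poly_ring X)"
  by (simp add: in_poly_ring_iff)

lemma poly_ring_one: "1 \<in> carrier (poly_ring X)"
  by (simp add: in_poly_ring_iff)

lemma poly_ring_uminus: "p \<in> carrier (poly_ring X) \<Longrightarrow> - p \<in> carrier (poly_ring X)"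
  by (simp add: in_poly_ring_iff)

lemma poly_ring_add:
  assumes "p \<in> carrier (poly_ring X)" "q \<in> carrier (poly_ring X)"
  shows "p + q \<in> carrier (poly_ring X)"
proof -
  interpret cring "poly_ring X" by (rule cring_poly_ring)
  show ?thesis using a_closed[OF assms] by simp
qed

lemma poly_ring_mult:
  assumes "p \<in> carrier (poly_ring X)" "q \<in> carrier (poly_ring X)"
  shows "p * q \<in> carrier (poly_ring X)"
proof -
  interpret cring "poly_ring X" by (rule cring_poly_ring)
  show ?thesis using m_closed[OF assms] by simp
qed

lemmas poly_ring_closed =
  poly_ring_zero poly_ring_one poly_ring_uminus poly_ring_add poly_ring_mult

section \<open>Degrees of monomials and homogeneous components of polynomials\<close>

lemma mdeg_eq_sum:
  assumes "finite A" "Poly_Mapping.keys m \<subseteq> A"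
  shows "mdeg m = (\<Sum>x\<in>A. Poly_Mapping.lookup m x)"
  unfolding mdeg_def using assms by (intro sum.mono_neutral_left) (auto simp: in_keys_iff)

lemma mdeg_add: "mdeg (a + b) = mdeg a + mdeg b"
proof -
  let ?A = "Poly_Mapping.keys a \<union> Poly_Mapping.keys b"
  have "mdeg m = (\<Sum>x\<in>?A. Poly_Mapping.lookup m x)" if "Poly_Mapping.keys m \<subseteq> ?A" for m
    using that by (intro mdeg_eq_sum) auto
  then show ?thesis
    by (simp add: Poly_Mapping.keys_add lookup_add sum.distrib)
qed

lemma mdeg_single [simp]: "mdeg (Poly_Mapping.single x n) = n"
  by (simp add: mdeg_def)

definition hcomp :: "nat \<Rightarrow> ('v, 'k::field) mpoly \<Rightarrow> ('v, 'k) mpoly" where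
  "hcomp d p = Poly_Mapping.mapp (\<lambda>m c. c when mdeg m = d) p"

lemma lookup_hcomp: "Poly_Mapping.lookup (hcomp d p) m = (Poly_Mapping.lookup p m when mdeg m = d)"
  by (auto simp: hcomp_def lookup_mapp when_def in_keys_iff)

lemma keys_hcomp: "Poly_Mapping.keys (hcomp d p) = {m \<in> Poly_Mapping.keys p. mdeg m = d}"
  by (auto simp: in_keys_iff lookup_hcomp)

lemma hcomp_closed: "p \<in> carrier (poly_ring X) \<Longrightarrow> hcomp d p \<in> carrier (poly_ring X)"
  by (auto simp: in_poly_ring_iff keys_hcomp)

lemma homogeneous_hcomp: "homogeneous d (hcomp d p)"
  by (auto simp: homogeneous_def keys_hcomp)

lemma hcomp_0 [simp]: "hcomp d 0 = 0"
  by (rule poly_mapping_eqI) (simp add: lookup_hcomp)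

lemma hcomp_add: "hcomp d (p + q) = hcomp d p + hcomp d q"
  by (rule poly_mapping_eqI) (simp add: lookup_hcomp lookup_add when_def)

lemma hcomp_sum: "hcomp d (sum f A) = (\<Sum>i\<in>A. hcomp d (f i))"
  by (induction A rule: infinite_finite_induct) (auto simp: hcomp_add)

lemma hcomp_homogeneous: "homogeneous d p \<Longrightarrow> hcomp d p = p"
  by (rule poly_mapping_eqI) (auto simp: lookup_hcomp homogeneous_def when_def in_keys_iff)

text \<open>Only the part of \<open>p\<close> in degree \<open>d\<close> can contribute to degree
  \<open>e + d\<close> of the product: the remainder \<open>r\<close> has no monomial of degree
  \<open>d\<close>, so \<open>l * r\<close> has none of degree \<open>e + d\<close>. Splitting off
  this one component avoids the full decomposition of \<open>p\<close>.\<close>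

lemma hcomp_mult_homogeneous:
  assumes "homogeneous e l"
  shows "hcomp (e + d) (l * p) = l * hcomp d p"
proof -
  define r where "r = p - hcomp d p"
  have r: "mdeg m \<noteq> d" if "m \<in> Poly_Mapping.keys r" for m
    using that by (auto simp: r_def in_keys_iff lookup_minus lookup_hcomp)
  have "homogeneous (e + d) (l * hcomp d p)"
    using assms keys_mult[of l "hcomp d p"] homogeneous_hcomp[of d p]
    by (fastforce simp: homogeneous_def mdeg_add)
  then have 1: "hcomp (e + d) (l * hcomp d p) = l * hcomp d p"
    by (rule hcomp_homogeneous)
  have "Poly_Mapping.keys (hcomp (e + d) (l * r)) = {}"
    using assms keys_mult[of l r] r by (fastforce simp: keys_hcomp homogeneous_def mdeg_add)
  then have 2: "hcomp (e + d) (l * r) = 0"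
    by simp
  have "l * p = l * hcomp d p + l * r"
    by (simp add: r_def algebra_simps)
  then show ?thesis
    by (simp add: hcomp_add 1 2)
qed


section \<open>Linear resolutions of submodules of free modules\<close>

lemma free_modD: "u \<in> free_mod X n \<Longrightarrow> u i \<in> carrier (poly_ring X)"
  by (cases "i < n") (auto simp: free_mod_def poly_ring_zero)

lemma free_mod_0: "free_mod X 0 = {\<lambda>_. 0}"
  by (auto simp: free_mod_def)

lemma row_app_add: "row_app n g (\<lambda>i. u i + v i) = row_app n g u + row_app n g v"
  by (simp add: row_app_def algebra_simps sum.distrib)

lemma row_app_scale: "row_app n g (\<lambda>i. p * u i) = p * row_app n g u"
  by (simp add: row_app_def algebra_simps sum_distrib_left)

lemma row_app_uminus: "row_app n g (\<lambda>i. - u i) = - row_app n g u"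
  by (simp add: row_app_def sum_negf)

lemma row_app_cong: "(\<And>i. i < n \<Longrightarrow> g i = h i) \<Longrightarrow> (\<And>i. i < n \<Longrightarrow> u i = v i) \<Longrightarrow> row_app n g u = row_app n h v"
  by (simp add: row_app_def)

lemma row_app_split:
  "row_app (m + n) g u = row_app m g u + row_app n (\<lambda>i. g (m + i)) (\<lambda>i. u (m + i))"
  by (induction n) (simp_all add: row_app_def)

lemma row_app_zero_left: "(\<And>i. i < n \<Longrightarrow> g i = 0) \<Longrightarrow> row_app n g u = 0"
  by (simp add: row_app_def)

lemma row_app_zero_right: "(\<And>i. i < n \<Longrightarrow> u i = 0) \<Longrightarrow> row_app n g u = 0"
  by (simp add: row_app_def)

lemma row_app_unit: "c < n \<Longrightarrow> row_app n g (\<lambda>i. if i = c then 1 else 0) = g c"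
  by (simp add: row_app_def if_distrib[of "\<lambda>x. _ * x"] cong: if_cong)

lemma hcomp_row_app:
  "(\<And>c. c < n \<Longrightarrow> homogeneous e (g c)) \<Longrightarrow> hcomp (e + d) (row_app n g u) = row_app n g (\<lambda>i. hcomp d (u i))"
  by (simp add: row_app_def hcomp_sum hcomp_mult_homogeneous)

text \<open>The columns of \<open>A\<close> generate \<open>M\<close>, and the same holds for their
  syzygies, and so on. Since every map has degree exactly 1, the degree shifts of the free modules
  are determined by their position and need not be recorded. The greatest fixed point is wanted
  because the sequence of matrices never has to stop; an empty matrix (\<open>b = 0\<close>) is
  allowed.\<close>

coinductive linear_res :: "'v set \<Rightarrow> nat \<Rightarrow> (nat \<Rightarrow> ('v, 'k::field) mpoly) set \<Rightarrow> bool" for X where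
  linear_resI: "(\<And>r c. r < n \<Longrightarrow> c < b \<Longrightarrow> A r c \<in> carrier (poly_ring X)) \<Longrightarrow>
    (\<And>r c. r < n \<Longrightarrow> c < b \<Longrightarrow> homogeneous 1 (A r c)) \<Longrightarrow>
    mat_app n b A ` free_mod X b = M \<Longrightarrow>
    linear_res X b {u \<in> free_mod X b. mat_app n b A u = (\<lambda>_. 0)} \<Longrightarrow> linear_res X n M"

text \<open>All basis vectors of the free module have the same degree, so a homogeneous component is
  taken entrywise. The last clause is what later allows a generator to be replaced by a linear
  one.\<close>

definition graded_submodule :: "'v set \<Rightarrow> nat \<Rightarrow> (nat \<Rightarrow> ('v, 'k::field) mpoly) set \<Rightarrow> bool" where
  "graded_submodule X n M \<longleftrightarrow> M \<subseteq> free_mod X n \<and> (\<lambda>_. 0) \<in> M \<and>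
     (\<forall>u\<in>M. \<forall>v\<in>M. (\<lambda>i. u i + v i) \<in> M) \<and>
     (\<forall>p\<in>carrier (poly_ring X). \<forall>u\<in>M. (\<lambda>i. p * u i) \<in> M) \<and>
     (\<forall>u\<in>M. \<forall>d. (\<lambda>i. hcomp d (u i)) \<in> M)"

lemma graded_submodule_add:
  "graded_submodule X n M \<Longrightarrow> u \<in> M \<Longrightarrow> v \<in> M \<Longrightarrow> (\<lambda>i. u i + v i) \<in> M"
  by (auto simp: graded_submodule_def)

lemma graded_submodule_scale:
  "graded_submodule X n M \<Longrightarrow> p \<in> carrier (poly_ring X) \<Longrightarrow> u \<in> M \<Longrightarrow> (\<lambda>i. p * u i) \<in> M"
  by (auto simp: graded_submodule_def)

lemma graded_submodule_diff:
  assumes M: "graded_submodule X n M" "u \<in> M" "v \<in> M"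
  shows "(\<lambda>i. u i - v i) \<in> M"
proof -
  have "(\<lambda>i. - 1 * v i) \<in> M"
    by (rule graded_submodule_scale[OF M(1) _ M(3)]) (intro poly_ring_closed)
  from graded_submodule_add[OF M(1,2) this] show ?thesis by simp
qed

lemma graded_submodule_row_app:
  assumes M: "graded_submodule X n M" "\<And>c. c < b \<Longrightarrow> v c \<in> M" "w \<in> free_mod X b"
  shows "(\<lambda>i. row_app b (\<lambda>c. v c i) w) \<in> M"
proof -
  have "a \<le> b \<Longrightarrow> (\<lambda>i. row_app a (\<lambda>c. v c i) w) \<in> M" for a
  proof (induction a)
    case 0
    then show ?case using M(1) by (simp add: row_app_def graded_submodule_def)
  next
    case (Suc a)
    have "(\<lambda>i. w a * v a i) \<in> M"
      using Suc.prems by (intro graded_submodule_scale[OF M(1)] M(2) free_modD[OF M(3)]) auto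
    from graded_submodule_add[OF M(1) Suc.IH this] Suc.prems show ?case
      by (simp add: row_app_def mult.commute)
  qed
  then show ?thesis by simp
qed

text \<open>A row of degree \<open>e\<close> raises the degree of every component by
  \<open>e\<close>, so it kills a vector exactly when it kills each component. The rows are indexed
  by an arbitrary type so that kernels of matrices and of a single augmentation row are both
  instances.\<close>

lemma graded_submodule_kernel:
  assumes "\<And>k c. c < n \<Longrightarrow> homogeneous e (B k c)"
  shows "graded_submodule X n {u \<in> free_mod X n. \<forall>k. row_app n (B k) u = 0}"
  unfolding graded_submodule_def
proof (intro conjI ballI allI)
  fix u d assume u: "u \<in> {u \<in> free_mod X n. \<forall>k. row_app n (B k) u = 0}"
  have "row_app n (B k) (\<lambda>i. hcomp d (u i)) = 0" for k
    using hcomp_row_app[where g = "B k" and e = e and n = n and d = d and u = u] assms u by simp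
  with u show "(\<lambda>i. hcomp d (u i)) \<in> {u \<in> free_mod X n. \<forall>k. row_app n (B k) u = 0}"
    by (auto simp: free_mod_def hcomp_closed)
qed (auto simp: free_mod_def poly_ring_closed row_app_add row_app_scale row_app_zero_right)

text \<open>The empty matrix generates the zero module, and its syzygies are the zero submodule of
  the free module of rank 0. The rank therefore has to vary in the coinduction.\<close>

lemma linear_res_0: "linear_res X n {\<lambda>_. 0}"
proof -
  have "n = n \<Longrightarrow> M = {\<lambda>_. 0} \<Longrightarrow> linear_res X n M" for n and M :: "(nat \<Rightarrow> ('a, 'b) mpoly) set"
  proof (coinduction arbitrary: n M)
    case linear_res
    have "mat_app n 0 (\<lambda>_ _. 0) (\<lambda>_. 0) = (\<lambda>_. 0 :: ('a, 'b) mpoly)"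
      by (simp add: mat_app_def row_app_def fun_eq_iff)
    with linear_res show ?case
      by (intro exI[of _ n] exI[of _ 0] exI[of _ "\<lambda>_ _. 0"]) (auto simp: free_mod_0)
  qed
  then show ?thesis by blast
qed

text \<open>The horseshoe lemma for \<open>0 \<longrightarrow> M' \<longrightarrow> M \<longrightarrow> M'' \<longrightarrow> 0\<close> with \<open>M \<subseteq> F' \<oplus> F''\<close>, where \<open>M' = M \<inter> F'\<close> and
  \<open>M''\<close> is the projection of \<open>M\<close> to \<open>F''\<close>; the syzygies of \<open>M\<close> are again in this position.\<close>

lemma linear_res_extension:
  assumes "graded_submodule X (n1 + n2) M"
    and "linear_res X n1 {u \<in> M. \<forall>i\<ge>n1. u i = 0}"
    and "linear_res X n2 ((\<lambda>u i. u (n1 + i)) ` M)"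
  shows "linear_res X (n1 + n2) M"
proof -
  have "linear_res X n M" if "\<exists>n1 n2. n = n1 + n2 \<and> graded_submodule X n M \<and>
    linear_res X n1 {u \<in> M. \<forall>i\<ge>n1. u i = 0} \<and> linear_res X n2 ((\<lambda>u i. u (n1 + i)) ` M)"
    for n and M :: "(nat \<Rightarrow> ('a, 'b) mpoly) set"
    using that
  proof (coinduction arbitrary: n M)
    case linear_res
    then obtain n1 n2 where n: "n = n1 + n2" and M: "graded_submodule X n M"
      and l1: "linear_res X n1 {u \<in> M. \<forall>i\<ge>n1. u i = 0}"
      and l2: "linear_res X n2 ((\<lambda>u i. u (n1 + i)) ` M)"
      by blast
    from l1 obtain b1 A1 where A1: "\<And>r c. r < n1 \<Longrightarrow> c < b1 \<Longrightarrow> A1 r c \<in> carrier (poly_ring X)"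
      "\<And>r c. r < n1 \<Longrightarrow> c < b1 \<Longrightarrow> homogeneous 1 (A1 r c)"
      and im1: "mat_app n1 b1 A1 ` free_mod X b1 = {u \<in> M. \<forall>i\<ge>n1. u i = 0}"
      and k1: "linear_res X b1 {u \<in> free_mod X b1. mat_app n1 b1 A1 u = (\<lambda>_. 0)}"
      by (cases rule: linear_res.cases) blast
    from l2 obtain b2 A2 where A2: "\<And>r c. r < n2 \<Longrightarrow> c < b2 \<Longrightarrow> A2 r c \<in> carrier (poly_ring X)"
      "\<And>r c. r < n2 \<Longrightarrow> c < b2 \<Longrightarrow> homogeneous 1 (A2 r c)"
      and im2: "mat_app n2 b2 A2 ` free_mod X b2 = (\<lambda>u i. u (n1 + i)) ` M"
      and k2: "linear_res X b2 {u \<in> free_mod X b2. mat_app n2 b2 A2 u = (\<lambda>_. 0)}"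
      by (cases rule: linear_res.cases) blast
    have Mfree: "u \<in> free_mod X n" if "u \<in> M" for u
      using M that by (auto simp: graded_submodule_def)
    \<comment> \<open>Lifts the columns of \<open>A2\<close> to \<open>M\<close>. An arbitrary lift
      may be inhomogeneous; passing to its component of degree 1 stays in \<open>M\<close> and
      leaves the lower entries alone, since those are linear already.\<close>
    have "\<exists>v\<in>M. (\<forall>i. homogeneous 1 (v i)) \<and> (\<forall>r<n2. v (n1 + r) = A2 r c)" if c: "c < b2" for c
    proof -
      let ?e = "\<lambda>i. if i = c then 1 else (0 :: ('a, 'b) mpoly)"
      have "?e \<in> free_mod X b2"
        using c by (auto simp: free_mod_def poly_ring_closed)
      then have "mat_app n2 b2 A2 ?e \<in> (\<lambda>u i. u (n1 + i)) ` M"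
        using im2 by blast
      then obtain v where v: "v \<in> M" "mat_app n2 b2 A2 ?e = (\<lambda>i. v (n1 + i))"
        by blast
      have "v (n1 + r) = A2 r c" if "r < n2" for r
        using fun_cong[OF v(2), of r] that c by (simp add: mat_app_def row_app_unit)
      then have "\<forall>r<n2. hcomp 1 (v (n1 + r)) = A2 r c"
        using A2(2) c by (simp add: hcomp_homogeneous)
      moreover have "(\<lambda>i. hcomp 1 (v i)) \<in> M"
        using M v(1) by (auto simp: graded_submodule_def)
      ultimately show ?thesis
        by (intro bexI[of _ "\<lambda>i. hcomp 1 (v i)"]) (auto simp: homogeneous_hcomp)
    qed
    then obtain v where v: "\<And>c. c < b2 \<Longrightarrow> v c \<in> M" "\<And>c i. c < b2 \<Longrightarrow> homogeneous 1 (v c i)"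
      "\<And>c r. c < b2 \<Longrightarrow> r < n2 \<Longrightarrow> v c (n1 + r) = A2 r c"
      by metis
    \<comment> \<open>Block triangular: \<open>A1\<close> over 0 on the left, the lifted columns on
      the right, whose lower part is \<open>A2\<close>. Correspondingly \<open>w1\<close> and
      \<open>w2\<close> cut a vector into its two blocks, and \<open>L\<close> applies the lifted
      columns.\<close>
    define A where "A r c = (if c < b1 then (if r < n1 then A1 r c else 0) else v (c - b1) r)" for r c
    define L where "L w = (\<lambda>i. row_app b2 (\<lambda>c. v c i) w)" for w
    define w1 where "w1 w = (\<lambda>i. if i < b1 then w i else 0)" for w :: "nat \<Rightarrow> ('a, 'b) mpoly"
    define w2 where "w2 w = (\<lambda>i. w (b1 + i))" for w :: "nat \<Rightarrow> ('a, 'b) mpoly"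
    have w12: "w1 w \<in> free_mod X b1" "w2 w \<in> free_mod X b2" if "w \<in> free_mod X (b1 + b2)" for w
      using that by (auto simp: w1_def w2_def free_mod_def)
    have LM: "L w \<in> M" if "w \<in> free_mod X b2" for w
      unfolding L_def using graded_submodule_row_app[OF M v(1) that] .
    have L2: "(\<lambda>i. L w (n1 + i)) = mat_app n2 b2 A2 w" if "w \<in> free_mod X b2" for w
    proof
      fix i
      show "L w (n1 + i) = mat_app n2 b2 A2 w i"
      proof (cases "i < n2")
        case True
        then show ?thesis by (simp add: L_def mat_app_def v(3) cong: row_app_cong)
      next
        case False
        then show ?thesis using Mfree[OF LM[OF that]] n by (auto simp: free_mod_def mat_app_def)
      qed
    qed
    have A1M: "mat_app n1 b1 A1 w \<in> M" if "w \<in> free_mod X b1" for w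
      using im1 that by blast
    have A_split: "mat_app n (b1 + b2) A w = (\<lambda>i. mat_app n1 b1 A1 (w1 w) i + L (w2 w) i)"
      if w: "w \<in> free_mod X (b1 + b2)" for w
    proof
      fix i
      have *: "row_app (b1 + b2) (A i) w = mat_app n1 b1 A1 (w1 w) i + L (w2 w) i"
        by (auto simp: row_app_split A_def mat_app_def w1_def w2_def L_def row_app_zero_left
          intro!: arg_cong2[of _ _ _ _ "(+)"] row_app_cong)
      show "mat_app n (b1 + b2) A w i = mat_app n1 b1 A1 (w1 w) i + L (w2 w) i"
      proof (cases "i < n")
        case True
        then show ?thesis using * by (simp add: mat_app_def)
      next
        case False
        have "(\<lambda>i. mat_app n1 b1 A1 (w1 w) i + L (w2 w) i) \<in> M"
          using w12[OF w] by (intro graded_submodule_add[OF M] A1M LM)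
        with False show ?thesis by (auto dest!: Mfree simp: free_mod_def mat_app_def[of n])
      qed
    qed
    have join: "\<exists>w\<in>free_mod X (b1 + b2). w1 w = u1 \<and> w2 w = u2"
      if "u1 \<in> free_mod X b1" "u2 \<in> free_mod X b2" for u1 u2
      using that
      by (intro bexI[of _ "\<lambda>i. if i < b1 then u1 i else u2 (i - b1)"])
        (auto simp: w1_def w2_def free_mod_def fun_eq_iff)
    \<comment> \<open>The diagram chase: subtracting the lift of the projection of \<open>u\<close>
      leaves an element of M', which \<open>A1\<close> reaches. It serves twice, for surjectivity
      onto \<open>M\<close> and, with \<open>u = 0\<close>, for extending a syzygy of M'' to one of
      \<open>M\<close>.\<close>
    have split_diff: "\<exists>z\<in>free_mod X b1. mat_app n1 b1 A1 z = (\<lambda>i. u i - L w i)"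
      if "u \<in> M" "w \<in> free_mod X b2" "(\<lambda>i. u (n1 + i)) = mat_app n2 b2 A2 w" for u w
    proof -
      have "(\<lambda>i. u i - L w i) \<in> M"
        using that by (intro graded_submodule_diff[OF M] LM)
      moreover have "u i - L w i = 0" if "i \<ge> n1" for i
        using fun_cong[OF L2[OF \<open>w \<in> free_mod X b2\<close>], of "i - n1"]
          fun_cong[OF \<open>(\<lambda>i. u (n1 + i)) = mat_app n2 b2 A2 w\<close>, of "i - n1"] that by simp
      ultimately have "(\<lambda>i. u i - L w i) \<in> mat_app n1 b1 A1 ` free_mod X b1"
        unfolding im1 by blast
      then show ?thesis by force
    qed
    let ?K = "{u \<in> free_mod X (b1 + b2). mat_app n (b1 + b2) A u = (\<lambda>_. 0)}"
    have hA: "homogeneous 1 (A r c)" if "c < b1 + b2" for r c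
    proof -
      have "homogeneous 1 (0 :: ('a, 'b) mpoly)" by (simp add: homogeneous_def)
      with that show ?thesis using A1(2) v(2)[of "c - b1"] by (auto simp: A_def)
    qed
    have A_closed: "A r c \<in> carrier (poly_ring X)" if "c < b1 + b2" for r c
      using that A1(1) free_modD[OF Mfree[OF v(1)[of "c - b1"]]]
      by (auto simp: A_def poly_ring_zero)
    have im: "mat_app n (b1 + b2) A ` free_mod X (b1 + b2) = M"
    proof (intro equalityI subsetI)
      fix u assume "u \<in> mat_app n (b1 + b2) A ` free_mod X (b1 + b2)"
      then obtain w where w: "w \<in> free_mod X (b1 + b2)" "u = mat_app n (b1 + b2) A w"
        by blast
      show "u \<in> M" unfolding w(2) A_split[OF w(1)]
        using w12[OF w(1)] by (intro graded_submodule_add[OF M] A1M LM)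
    next
      fix u assume u: "u \<in> M"
      then have "(\<lambda>i. u (n1 + i)) \<in> mat_app n2 b2 A2 ` free_mod X b2"
        unfolding im2 by blast
      then obtain u2 where u2: "u2 \<in> free_mod X b2" "(\<lambda>i. u (n1 + i)) = mat_app n2 b2 A2 u2"
        by blast
      obtain u1 where u1: "u1 \<in> free_mod X b1" "mat_app n1 b1 A1 u1 = (\<lambda>i. u i - L u2 i)"
        using split_diff[OF u u2] by blast
      obtain w where w: "w \<in> free_mod X (b1 + b2)" "w1 w = u1" "w2 w = u2"
        using join[OF u1(1) u2(1)] by blast
      have "mat_app n (b1 + b2) A w = u"
        using A_split[OF w(1)] by (simp add: w u1)
      then show "u \<in> mat_app n (b1 + b2) A ` free_mod X (b1 + b2)"
        using w(1) by blast
    qed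
    \<comment> \<open>Rows from \<open>n\<close> on are replaced by zero, because the kernel lemma
      quantifies over all row indices.\<close>
    have "?K = {u \<in> free_mod X (b1 + b2). \<forall>k. row_app (b1 + b2) (if k < n then A k else (\<lambda>_. 0)) u = 0}"
      by (auto simp: mat_app_def fun_eq_iff row_app_zero_left split: if_splits)
    moreover have "graded_submodule X (b1 + b2) \<dots>"
      using hA by (intro graded_submodule_kernel[where e = 1]) (auto simp: homogeneous_def)
    ultimately have K: "graded_submodule X (b1 + b2) ?K" by simp
    have K1: "{u \<in> ?K. \<forall>i\<ge>b1. u i = 0} = {u \<in> free_mod X b1. mat_app n1 b1 A1 u = (\<lambda>_. 0)}"
    proof -
      have eq: "mat_app n (b1 + b2) A u = mat_app n1 b1 A1 u"
        if u: "u \<in> free_mod X (b1 + b2)" "\<forall>i\<ge>b1. u i = 0" for u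
      proof -
        have "w1 u = u" using u(2) by (auto simp: w1_def fun_eq_iff)
        moreover have "L (w2 u) = (\<lambda>_. 0)"
          using u(2) by (simp add: w2_def L_def row_app_zero_right)
        ultimately show ?thesis using A_split[OF u(1)] by simp
      qed
      have "u \<in> free_mod X (b1 + b2) \<and> (\<forall>i\<ge>b1. u i = 0) \<longleftrightarrow> u \<in> free_mod X b1" for u
        by (auto simp: free_mod_def) (metis not_le poly_ring_zero)
      with eq show ?thesis by (smt (verit) Collect_cong mem_Collect_eq)
    qed
    have K2: "(\<lambda>u i. u (b1 + i)) ` ?K = {u \<in> free_mod X b2. mat_app n2 b2 A2 u = (\<lambda>_. 0)}"
    proof (intro equalityI subsetI)
      fix z assume "z \<in> (\<lambda>u i. u (b1 + i)) ` ?K"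
      then obtain w where w: "w \<in> free_mod X (b1 + b2)" "mat_app n (b1 + b2) A w = (\<lambda>_. 0)"
        "z = w2 w" unfolding w2_def by blast
      have "mat_app n2 b2 A2 (w2 w) = (\<lambda>i. mat_app n (b1 + b2) A w (n1 + i))"
        unfolding A_split[OF w(1)] L2[OF w12(2)[OF w(1)], symmetric]
        by (simp add: mat_app_def)
      with w w12 show "z \<in> {u \<in> free_mod X b2. mat_app n2 b2 A2 u = (\<lambda>_. 0)}" by simp
    next
      fix z assume z: "z \<in> {u \<in> free_mod X b2. mat_app n2 b2 A2 u = (\<lambda>_. 0)}"
      have "(\<lambda>_. 0) \<in> M" using M by (simp add: graded_submodule_def)
      then obtain u1 where u1: "u1 \<in> free_mod X b1" "mat_app n1 b1 A1 u1 = (\<lambda>i. 0 - L z i)"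
        using split_diff[of "\<lambda>_. 0" z] z by (smt (verit) mem_Collect_eq)
      obtain w where w: "w \<in> free_mod X (b1 + b2)" "w1 w = u1" "w2 w = z"
        using join[OF u1(1)] z by blast
      have "w \<in> ?K" using A_split[OF w(1)] by (simp add: w u1)
      then have "w2 w \<in> (\<lambda>u i. u (b1 + i)) ` ?K"
        unfolding w2_def by (rule imageI)
      then show "z \<in> (\<lambda>u i. u (b1 + i)) ` ?K" by (simp add: w)
    qed
    have ext: "\<exists>m1 m2. b1 + b2 = m1 + m2 \<and> graded_submodule X (b1 + b2) ?K \<and>
        linear_res X m1 {u \<in> ?K. \<forall>i\<ge>m1. u i = 0} \<and> linear_res X m2 ((\<lambda>u i. u (m1 + i)) ` ?K)"
      by (rule exI[of _ b1], rule exI[of _ b2], unfold K1 K2) (intro conjI refl K k1 k2)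
    show ?case
    proof (rule exI[of _ n], rule exI[of _ "b1 + b2"], rule exI[of _ A], rule exI[of _ M],
        intro conjI refl allI impI)
      show "mat_app n (b1 + b2) A ` free_mod X (b1 + b2) = M" by (rule im)
    next
      show "(\<exists>n M. b1 + b2 = n \<and> ?K = M \<and> (\<exists>n1 n2. n = n1 + n2 \<and> graded_submodule X n M \<and>
          linear_res X n1 {u \<in> M. \<forall>i\<ge>n1. u i = 0} \<and> linear_res X n2 ((\<lambda>u i. u (n1 + i)) ` M)))
        \<or> linear_res X (b1 + b2) ?K"
        by (rule disjI1, rule exI, rule exI, rule conjI[OF refl], rule conjI[OF refl], rule ext)
    qed (erule A_closed hA)+
  qed
  with assms show ?thesis by blast
qed

section \<open>Ideals generated in a single degree and their extension by one generator\<close>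

definition linear_res_ideal :: "'v set \<Rightarrow> nat \<Rightarrow> ('v, 'k::field) mpoly set \<Rightarrow> bool" where
  "linear_res_ideal X d I \<longleftrightarrow> (\<exists>b g. (\<forall>c<b. g c \<in> carrier (poly_ring X) \<and> homogeneous d (g c)) \<and>
     row_app b g ` free_mod X b = I \<and> linear_res X b {u \<in> free_mod X b. row_app b g u = 0})"

lemma linear_res_ideal_0: "linear_res_ideal X d {0}"
  unfolding linear_res_ideal_def
  by (rule exI[of _ 0], rule exI[of _ "\<lambda>_. 0"])
    (auto simp: free_mod_0 row_app_def linear_res_0)

text \<open>In the extension step the colon ideal appears as the last coordinate of syzygies, so it
  has to be viewed as a submodule of the free module of rank 1. Its generators, being linear forms,
  become the single row of the first matrix.\<close>

lemma linear_res_embed: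
  assumes "linear_res_ideal X 1 C"
  shows "linear_res X 1 ((\<lambda>f i. if i = 0 then f else 0) ` C)"
proof -
  from assms obtain b g where g: "\<And>c. c < b \<Longrightarrow> g c \<in> carrier (poly_ring X)"
      "\<And>c. c < b \<Longrightarrow> homogeneous 1 (g c)"
    and C: "row_app b g ` free_mod X b = C"
    and K: "linear_res X b {u \<in> free_mod X b. row_app b g u = 0}"
    unfolding linear_res_ideal_def by auto
  have m: "mat_app 1 b (\<lambda>_. g) u = (\<lambda>i. if i = 0 then row_app b g u else 0)" for u
    by (auto simp: mat_app_def fun_eq_iff)
  have "mat_app 1 b (\<lambda>_. g) u = (\<lambda>_. 0) \<longleftrightarrow> row_app b g u = 0" for u
    unfolding m by (auto simp: fun_eq_iff)
  with g K show ?thesis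
    unfolding C[symmetric]
    by (intro linear_resI[of 1 b "\<lambda>_. g"]) (simp_all add: m image_image del: One_nat_def)
qed

text \<open>The syzygies of the generators of \<open>J\<close> together with \<open>u\<close> fit
  the horseshoe: those with last coordinate 0 are the syzygies of \<open>J\<close>, and the last
  coordinates that occur form the colon ideal of \<open>J\<close> by \<open>u\<close>. A relation
  expressing \<open>f * u\<close> through the generators of \<open>J\<close> gives the syzygy with
  last coordinate \<open>f\<close> and the other coefficients negated.\<close>

lemma linear_res_ideal_extend:
  assumes J: "linear_res_ideal X d J"
    and u: "u \<in> carrier (poly_ring X)" "homogeneous d u"
    and C: "linear_res_ideal X 1 {f \<in> carrier (poly_ring X). f * u \<in> J}"
  shows "linear_res_ideal X d {j + f * u | j f. j \<in> J \<and> f \<in> carrier (poly_ring X)}"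
proof -
  from J obtain b g where g: "\<And>c. c < b \<Longrightarrow> g c \<in> carrier (poly_ring X)"
      "\<And>c. c < b \<Longrightarrow> homogeneous d (g c)"
    and J_eq: "row_app b g ` free_mod X b = J"
    and K: "linear_res X b {u \<in> free_mod X b. row_app b g u = 0}"
    unfolding linear_res_ideal_def by auto
  define h where "h c = (if c < b then g c else u)" for c
  have split: "row_app (Suc b) h w = row_app b g w + w b * u" for w
    by (simp add: row_app_def h_def)
  have extend: "(\<lambda>i. if i < b then w i else if i = b then f else 0) \<in> free_mod X (Suc b)"
    "row_app b g (\<lambda>i. if i < b then w i else if i = b then f else 0) = row_app b g w"
    if "w \<in> free_mod X b" "f \<in> carrier (poly_ring X)" for w f
    using that by (auto simp: free_mod_def row_app_def)
  have restrict: "(\<lambda>i. if i < b then w i else 0) \<in> free_mod X b"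
    "row_app b g (\<lambda>i. if i < b then w i else 0) = row_app b g w"
    if "w \<in> free_mod X (Suc b)" for w
    using that by (auto simp: free_mod_def row_app_def)
  let ?S = "{w \<in> free_mod X (Suc b). row_app (Suc b) h w = 0}"
  have "graded_submodule X (Suc b) {w \<in> free_mod X (Suc b). \<forall>k::nat. row_app (Suc b) h w = 0}"
    using g u by (intro graded_submodule_kernel[where e = d and B = "\<lambda>_. h"]) (auto simp: h_def)
  then have S: "graded_submodule X (b + 1) ?S" by simp
  have "w \<in> free_mod X (Suc b) \<and> (\<forall>i\<ge>b. w i = 0) \<longleftrightarrow> w \<in> free_mod X b" for w
    by (auto simp: free_mod_def less_Suc_eq poly_ring_zero)
  then have S1: "{w \<in> ?S. \<forall>i\<ge>b. w i = 0} = {w \<in> free_mod X b. row_app b g w = 0}"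
    by (auto simp: split) (auto simp: free_mod_def)
  have S2: "(\<lambda>w i. w (b + i)) ` ?S =
    (\<lambda>f i. if i = 0 then f else 0) ` {f \<in> carrier (poly_ring X). f * u \<in> J}"
  proof (intro equalityI subsetI)
    fix z assume "z \<in> (\<lambda>w i. w (b + i)) ` ?S"
    then obtain w where w: "w \<in> free_mod X (Suc b)" "row_app b g w + w b * u = 0"
      "z = (\<lambda>i. w (b + i))" unfolding split by blast
    have "w b * u = row_app b g (\<lambda>i. - (if i < b then w i else 0))"
      using w(2) restrict(2)[OF w(1)] by (simp only: row_app_uminus)
        (simp add: eq_neg_iff_add_eq_0 add.commute)
    moreover have "(\<lambda>i. - (if i < b then w i else 0)) \<in> free_mod X b"
      using restrict(1)[OF w(1)] by (auto simp: free_mod_def poly_ring_closed)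
    ultimately have "w b * u \<in> J" unfolding J_eq[symmetric] by (rule image_eqI)
    moreover have "z = (\<lambda>i. if i = 0 then w b else 0)"
      using w(1,3) by (auto simp: free_mod_def fun_eq_iff)
    ultimately show "z \<in> (\<lambda>f i. if i = 0 then f else 0) ` {f \<in> carrier (poly_ring X). f * u \<in> J}"
      by (intro image_eqI[of _ _ "w b"] CollectI conjI free_modD[OF w(1)])
  next
    fix z :: "nat \<Rightarrow> ('a, 'b) mpoly"
    assume "z \<in> (\<lambda>f i. if i = 0 then f else 0) ` {f \<in> carrier (poly_ring X). f * u \<in> J}"
    then obtain f where f: "f \<in> carrier (poly_ring X)" "f * u \<in> J"
      "z = (\<lambda>i. if i = 0 then f else 0)" by blast
    then obtain v where v: "v \<in> free_mod X b" "f * u = row_app b g v" using J_eq by blast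
    define w where "w = (\<lambda>i. if i < b then - v i else if i = b then f else 0)"
    have "(\<lambda>i. - v i) \<in> free_mod X b"
      using v(1) by (auto simp: free_mod_def poly_ring_closed)
    note e = extend[OF this f(1), folded w_def]
    have "w b = f" by (simp add: w_def)
    with e v(2) have "w \<in> ?S" by (simp add: split row_app_uminus)
    moreover have "z = (\<lambda>i. w (b + i))" by (auto simp: f(3) w_def fun_eq_iff)
    ultimately show "z \<in> (\<lambda>w i. w (b + i)) ` ?S" by (intro image_eqI)
  qed
  have "linear_res X (b + 1) ?S"
    by (rule linear_res_extension[OF S]) (use K linear_res_embed[OF C] in \<open>simp_all only: S1 S2\<close>)
  moreover have "row_app (Suc b) h ` free_mod X (Suc b) =
    {j + f * u | j f. j \<in> J \<and> f \<in> carrier (poly_ring X)}"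
  proof (intro equalityI subsetI)
    fix z assume "z \<in> row_app (Suc b) h ` free_mod X (Suc b)"
    then obtain w where w: "w \<in> free_mod X (Suc b)" "z = row_app b g w + w b * u"
      by (auto simp: split)
    have "row_app b g w \<in> J"
      unfolding J_eq[symmetric] restrict(2)[OF w(1), symmetric]
      using restrict(1)[OF w(1)] by (rule imageI)
    with w free_modD[OF w(1)] show "z \<in> {j + f * u | j f. j \<in> J \<and> f \<in> carrier (poly_ring X)}"
      by blast
  next
    fix z assume "z \<in> {j + f * u | j f. j \<in> J \<and> f \<in> carrier (poly_ring X)}"
    then obtain v f where "v \<in> free_mod X b" "f \<in> carrier (poly_ring X)" "z = row_app b g v + f * u"
      using J_eq by blast
    with extend[of v f] show "z \<in> row_app (Suc b) h ` free_mod X (Suc b)"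
      by (intro image_eqI[of _ _ "\<lambda>i. if i < b then v i else if i = b then f else 0"])
        (auto simp: split)
  qed
  ultimately show ?thesis
    unfolding linear_res_ideal_def using g u
    by (intro exI[of _ "Suc b"] exI[of _ h]) (auto simp: h_def)
qed

text \<open>Unfolds the coinductive predicate into actual sequences. The next matrix depends on the
  current rank and module, so choice functions \<open>B\<close> and \<open>A\<close> of both are
  fixed and \<open>step\<close> is iterated on such pairs; the module at stage \<open>i\<close> is
  the one that the matrix \<open>D i\<close> must generate.\<close>

lemma has_linear_resolution_if_linear_res_ideal:
  assumes "linear_res_ideal X d I"
  shows "has_linear_resolution X I"
proof -
  from assms obtain b0 g where g: "\<And>c. c < b0 \<Longrightarrow> g c \<in> carrier (poly_ring X)"
      "\<And>c. c < b0 \<Longrightarrow> homogeneous d (g c)"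
    and I: "row_app b0 g ` free_mod X b0 = I"
    and K: "linear_res X b0 {u \<in> free_mod X b0. row_app b0 g u = 0}"
    unfolding linear_res_ideal_def by auto
  define is_step where "is_step n M b A \<longleftrightarrow>
    (\<forall>r<n. \<forall>c<b. A r c \<in> carrier (poly_ring X) \<and> homogeneous 1 (A r c)) \<and>
    mat_app n b A ` free_mod X b = M \<and>
    linear_res X b {u \<in> free_mod X b. mat_app n b A u = (\<lambda>_. 0)}"
    for n b A and M :: "(nat \<Rightarrow> ('a, 'b) mpoly) set"
  have "\<exists>b A. linear_res X n M \<longrightarrow> is_step n M b A" for n M
  proof (cases "linear_res X n M")
    case True
    then show ?thesis
    proof cases
      case (linear_resI b A)
      then show ?thesis unfolding is_step_def by (intro exI[of _ b] exI[of _ A]) simp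
    qed
  qed simp
  then obtain B A where BA: "\<And>n M. linear_res X n M \<Longrightarrow> is_step n M (B n M) (A n M)"
    by metis
  note BA = BA[unfolded is_step_def]
  define step where "step = (\<lambda>(n, M).
    (B n M, {u \<in> free_mod X (B n M). mat_app n (B n M) (A n M) u = (\<lambda>_. 0)}))"
  define s where "s i = (step ^^ i) (b0, {u \<in> free_mod X b0. row_app b0 g u = 0})" for i
  define b where "b i = fst (s i)" for i
  define M where "M i = snd (s i)" for i
  define D where "D i = A (b i) (M i)" for i
  have s0: "b 0 = b0" "M 0 = {u \<in> free_mod X b0. row_app b0 g u = 0}"
    by (simp_all add: b_def M_def s_def)
  have sS: "b (Suc i) = B (b i) (M i)"
    "M (Suc i) = {u \<in> free_mod X (b (Suc i)). mat_app (b i) (b (Suc i)) (D i) u = (\<lambda>_. 0)}" for i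
    by (simp_all add: b_def M_def s_def step_def D_def split: prod.splits)
  have lin: "linear_res X (b i) (M i)" for i
  proof (induction i)
    case 0
    then show ?case using K by (simp add: s0)
  next
    case (Suc i)
    from BA[OF Suc.IH] show ?case by (simp add: sS D_def)
  qed
  have D: "D i r c \<in> carrier (poly_ring X)" "homogeneous 1 (D i r c)"
    if "r < b i" "c < b (Suc i)" for i r c
    using BA[OF lin[of i]] that by (simp_all add: D_def sS)
  have im: "mat_app (b i) (b (Suc i)) (D i) ` free_mod X (b (Suc i)) = M i" for i
    using BA[OF lin[of i]] by (simp add: D_def sS)
  have "graded_free_resolution X I b (\<lambda>i j. d + i) g D"
    unfolding graded_free_resolution_def
  proof (intro conjI allI impI)
    show "mat_app (b 0) (b 1) (D 0) ` free_mod X (b 1) = {u \<in> free_mod X (b 0). row_app (b 0) g u = 0}"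
      using im[of 0] by (simp add: s0)
    show "mat_app (b (Suc i)) (b (Suc (Suc i))) (D (Suc i)) ` free_mod X (b (Suc (Suc i))) =
        {u \<in> free_mod X (b (Suc i)). mat_app (b i) (b (Suc i)) (D i) u = (\<lambda>_. 0)}" for i
      using im[of "Suc i"] by (simp add: sS(2))
  qed (use g I D in \<open>auto simp: s0 homogeneous_def\<close>)
  \<comment> \<open>Minimality: a homogeneous entry of degree 1 has no constant term.\<close>
  moreover have "Poly_Mapping.lookup (D i r c) 0 = 0" if "r < b i" "c < b (Suc i)" for i r c
    using D(2)[OF that] unfolding homogeneous_def not_in_keys_iff_lookup_eq_zero[symmetric]
    by (auto dest!: bspec[of _ _ 0] simp: mdeg_def)
  ultimately show ?thesis
    unfolding has_linear_resolution_def minimal_graded_free_resolution_def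
    by (intro exI[of _ d] exI[of _ b] exI[of _ "\<lambda>i j. d + i"] exI[of _ g] exI[of _ D]) simp
qed


section \<open>Monomial ideals\<close>

definition monomials :: "'v set \<Rightarrow> ('v \<Rightarrow>\<^sub>0 nat) set" where
  "monomials X = {m. Poly_Mapping.keys m \<subseteq> X}"

definition mono_dvd :: "('v \<Rightarrow>\<^sub>0 nat) \<Rightarrow> ('v \<Rightarrow>\<^sub>0 nat) \<Rightarrow> bool" where
  "mono_dvd a b \<longleftrightarrow> (\<forall>x. Poly_Mapping.lookup a x \<le> Poly_Mapping.lookup b x)"

text \<open>A monomial ideal is represented by the set of all its monomials. Intersections and
  colons by a monomial then become operations on sets of exponent vectors.\<close>

definition mono_span :: "('v \<Rightarrow>\<^sub>0 nat) set \<Rightarrow> ('v, 'k::field) mpoly set" where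
  "mono_span A = {f. Poly_Mapping.keys f \<subseteq> A}"

definition mono_upclosed :: "'v set \<Rightarrow> ('v \<Rightarrow>\<^sub>0 nat) set \<Rightarrow> bool" where
  "mono_upclosed X A \<longleftrightarrow> A \<subseteq> monomials X \<and> (\<forall>a\<in>A. \<forall>m\<in>monomials X. m + a \<in> A)"

definition mono_multiples :: "'v set \<Rightarrow> ('v \<Rightarrow>\<^sub>0 nat) set \<Rightarrow> ('v \<Rightarrow>\<^sub>0 nat) set" where
  "mono_multiples X B = {m \<in> monomials X. \<exists>b\<in>B. mono_dvd b m}"

lemma carrier_poly_ring: "carrier (poly_ring X) = mono_span (monomials X)"
  unfolding mono_span_def monomials_def by (fastforce simp: in_poly_ring_iff)

lemma monomials_add: "a \<in> monomials X \<Longrightarrow> b \<in> monomials X \<Longrightarrow> a + b \<in> monomials X"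
  using Poly_Mapping.keys_add[of a b] by (auto simp: monomials_def)

lemma monomials_diff: "a \<in> monomials X \<Longrightarrow> a - b \<in> monomials X"
  by (auto simp: monomials_def in_keys_iff lookup_minus)

lemma monomials_single: "x \<in> X \<Longrightarrow> Poly_Mapping.single x n \<in> monomials X"
  by (auto simp: monomials_def)

lemma mono_dvd_diff_add: "mono_dvd a b \<Longrightarrow> (b - a) + a = b"
  by (rule poly_mapping_eqI) (simp add: mono_dvd_def lookup_add lookup_minus)

lemma mono_dvd_refl: "mono_dvd a a"
  by (simp add: mono_dvd_def)

lemma mono_upclosed_multiples: "mono_upclosed X (mono_multiples X B)"
  by (fastforce simp: mono_upclosed_def mono_multiples_def monomials_add mono_dvd_def lookup_add
    intro: trans_le_add2)

lemma mono_span_add: "f \<in> mono_span A \<Longrightarrow> g \<in> mono_span A \<Longrightarrow> f + g \<in> mono_span A"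
  using Poly_Mapping.keys_add[of f g] by (auto simp: mono_span_def)

lemma mono_span_mono: "A \<subseteq> B \<Longrightarrow> mono_span A \<subseteq> mono_span B"
  by (auto simp: mono_span_def)

lemma mono_span_single: "a \<in> A \<Longrightarrow> Poly_Mapping.single a c \<in> mono_span A"
  by (auto simp: mono_span_def)

lemma mono_span_mult:
  assumes "mono_upclosed X A" "f \<in> carrier (poly_ring X)" "g \<in> mono_span A"
  shows "f * g \<in> mono_span A"
  using assms keys_mult[of f g] unfolding carrier_poly_ring mono_span_def mono_upclosed_def by blast

lemma poly_mapping_sum_singles:
  "f = (\<Sum>m\<in>Poly_Mapping.keys f. Poly_Mapping.single m (Poly_Mapping.lookup f m))"
  by (rule poly_mapping_eqI)
    (auto simp: lookup_sum lookup_single when_def not_in_keys_iff_lookup_eq_zero)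

lemma mono_span_subsetI:
  assumes "0 \<in> Q" "\<And>f g. f \<in> Q \<Longrightarrow> g \<in> Q \<Longrightarrow> f + g \<in> Q"
    and "\<And>a c. a \<in> A \<Longrightarrow> Poly_Mapping.single a c \<in> Q"
  shows "mono_span A \<subseteq> Q"
proof
  fix f :: "('a, 'b) mpoly" assume f: "f \<in> mono_span A"
  have "B \<subseteq> A \<Longrightarrow> (\<Sum>m\<in>B. Poly_Mapping.single m (Poly_Mapping.lookup f m)) \<in> Q" for B
    by (induction B rule: infinite_finite_induct) (auto simp: assms)
  with f show "f \<in> Q" by (subst poly_mapping_sum_singles) (simp add: mono_span_def)
qed

lemma ideal_mono_span:
  assumes "mono_upclosed X A"
  shows "ideal (mono_span A :: ('v, 'k::field) mpoly set) (poly_ring X)"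
proof -
  interpret cring "poly_ring X :: ('v, 'k) mpoly ring" by (rule cring_poly_ring)
  have sub: "mono_span A \<subseteq> (carrier (poly_ring X) :: ('v, 'k) mpoly set)"
    using assms by (auto simp: carrier_poly_ring mono_upclosed_def intro!: mono_span_mono)
  have "a_inv (poly_ring X) f = - f" if "f \<in> carrier (poly_ring X)" for f :: "('v, 'k) mpoly"
    using minus_equality[of "- f" f] that by (simp add: poly_ring_uminus)
  then have inv: "a_inv (poly_ring X) f \<in> mono_span A" if "f \<in> mono_span A" for f :: "('v, 'k) mpoly"
    using subsetD[OF sub that] that by (simp add: mono_span_def)
  have "0 \<in> (mono_span A :: ('v, 'k) mpoly set)" by (simp add: mono_span_def)
  then have "subgroup (mono_span A :: ('v, 'k) mpoly set) (add_monoid (poly_ring X))"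
    using inv by (intro add.subgroupI sub) (auto simp: mono_span_add)
  then show ?thesis
    using mono_span_mult[OF assms] by (intro idealI ring_axioms) (auto, metis mult.commute)
qed

text \<open>The generating set \<open>H\<close> may contain polynomials that are not monomials, as
  happens for sets of homogeneous elements; it only has to contain, for each monomial of the ideal,
  some monomial dividing it.\<close>

lemma genideal_eq_mono_span:
  assumes A: "mono_upclosed X A" and H: "H \<subseteq> mono_span A"
    and gen: "\<And>a. a \<in> A \<Longrightarrow> \<exists>b. Poly_Mapping.single b 1 \<in> H \<and> mono_dvd b a"
  shows "Idl\<^bsub>poly_ring X\<^esub> H = (mono_span A :: ('v, 'k::field) mpoly set)"
proof
  interpret cring "poly_ring X :: ('v, 'k) mpoly ring" by (rule cring_poly_ring)
  show "Idl\<^bsub>poly_ring X\<^esub> H \<subseteq> mono_span A"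
    using genideal_minimal[OF ideal_mono_span[OF A] H] .
  have "H \<subseteq> carrier (poly_ring X)"
    using H A mono_span_mono[of A "monomials X"] by (auto simp: carrier_poly_ring mono_upclosed_def)
  note I = genideal_ideal[OF this]
  show "mono_span A \<subseteq> Idl\<^bsub>poly_ring X\<^esub> H"
  proof (rule mono_span_subsetI)
    show "0 \<in> Idl\<^bsub>poly_ring X\<^esub> H"
      using additive_subgroup.zero_closed[OF ideal.axioms(1)[OF I]] by simp
  next
    fix f g assume "f \<in> Idl\<^bsub>poly_ring X\<^esub> H" "g \<in> Idl\<^bsub>poly_ring X\<^esub> H"
    then show "f + g \<in> Idl\<^bsub>poly_ring X\<^esub> H"
      using additive_subgroup.a_closed[OF ideal.axioms(1)[OF I]] by simp
  next
    fix a and c :: 'k assume a: "a \<in> A"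
    then obtain b where b: "Poly_Mapping.single b 1 \<in> H" "mono_dvd b a" using gen by blast
    have "a - b \<in> monomials X"
      using a A by (auto simp: mono_upclosed_def intro: monomials_diff)
    then have "Poly_Mapping.single (a - b) c \<in> carrier (poly_ring X)"
      by (simp add: carrier_poly_ring mono_span_single)
    moreover have "Poly_Mapping.single b 1 \<in> Idl\<^bsub>poly_ring X\<^esub> H"
      using b(1) genideal_self[OF \<open>H \<subseteq> carrier (poly_ring X)\<close>] by blast
    ultimately have "Poly_Mapping.single (a - b) c * Poly_Mapping.single b 1 \<in> Idl\<^bsub>poly_ring X\<^esub> H"
      using ideal.I_l_closed[OF I] by simp
    then show "Poly_Mapping.single a c \<in> Idl\<^bsub>poly_ring X\<^esub> H"
      by (simp add: mult_single mono_dvd_diff_add[OF b(2)])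
  qed
qed

section \<open>Linear quotients of monomial ideals\<close>

lemma lookup_times_single:
  fixes f :: "('v, 'k::field) mpoly"
  shows "Poly_Mapping.lookup (f * Poly_Mapping.single b c) (m + b) = Poly_Mapping.lookup f m * c"
proof -
  have "(\<Sum>q. Poly_Mapping.lookup (Poly_Mapping.single b c) q when k = l + q) = (c when k = l + b)"
    for k l
  proof -
    have "(\<Sum>q. Poly_Mapping.lookup (Poly_Mapping.single b c) q when k = l + q) =
      (\<Sum>q. (c when k = l + b) when b = q)"
      by (rule Sum_any.cong) (auto simp: lookup_single when_def)
    then show ?thesis by simp
  qed
  moreover have "(\<Sum>l. Poly_Mapping.lookup f l * (c when m = l)) =
      (\<Sum>l. (Poly_Mapping.lookup f l * c) when l = m)"
    by (rule Sum_any.cong) (auto simp: when_def)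
  ultimately show ?thesis by (simp add: lookup_mult)
qed

text \<open>Multiplying by a monomial translates exponents without cancellation. Equality, and not
  just the inclusion that holds for general products, is what makes the colon by a monomial the span
  of the translated exponent set.\<close>

lemma keys_times_single:
  fixes f :: "('v, 'k::field) mpoly"
  shows "Poly_Mapping.keys (f * Poly_Mapping.single b 1) = (\<lambda>m. m + b) ` Poly_Mapping.keys f"
proof (intro equalityI subsetI)
  fix n assume "n \<in> Poly_Mapping.keys (f * Poly_Mapping.single b 1)"
  with keys_mult[of f "Poly_Mapping.single b 1"] show "n \<in> (\<lambda>m. m + b) ` Poly_Mapping.keys f"
    by (auto split: if_splits)
qed (auto simp: in_keys_iff lookup_times_single)

lemma linear_res_ideal_mono_insert:
  assumes A: "mono_upclosed X A" "linear_res_ideal X d (mono_span A :: ('v, 'k::field) mpoly set)"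
    and b: "b \<in> monomials X" "mdeg b = d"
    and C: "linear_res_ideal X 1 (mono_span {m \<in> monomials X. m + b \<in> A} :: ('v, 'k) mpoly set)"
  shows "linear_res_ideal X d (mono_span (A \<union> (\<lambda>m. m + b) ` monomials X) :: ('v, 'k) mpoly set)"
proof -
  let ?u = "Poly_Mapping.single b 1 :: ('v, 'k) mpoly"
  have u: "?u \<in> carrier (poly_ring X)" "homogeneous d ?u"
    using b by (auto simp: carrier_poly_ring mono_span_single homogeneous_def)
  have "{f \<in> carrier (poly_ring X). f * ?u \<in> mono_span A} =
      mono_span {m \<in> monomials X. m + b \<in> A}"
    by (auto simp: carrier_poly_ring mono_span_def keys_times_single)
  then have "linear_res_ideal X 1 {f \<in> carrier (poly_ring X). f * ?u \<in> mono_span A}"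
    using C by simp
  note ext = linear_res_ideal_extend[OF A(2) u this]
  let ?Q = "{j + f * ?u | j f. j \<in> mono_span A \<and> f \<in> carrier (poly_ring X)}"
  have "?Q = mono_span (A \<union> (\<lambda>m. m + b) ` monomials X)"
  proof
    show "?Q \<subseteq> mono_span (A \<union> (\<lambda>m. m + b) ` monomials X)"
    proof
      fix z assume "z \<in> ?Q"
      then obtain j f where z: "z = j + f * ?u" "j \<in> mono_span A" "f \<in> carrier (poly_ring X)"
        by blast
      show "z \<in> mono_span (A \<union> (\<lambda>m. m + b) ` monomials X)"
        unfolding z(1) using z(2,3)
        by (intro mono_span_add) (auto simp: mono_span_def carrier_poly_ring keys_times_single)
    qed
    show "mono_span (A \<union> (\<lambda>m. m + b) ` monomials X) \<subseteq> ?Q"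
    proof (rule mono_span_subsetI)
      show "0 \<in> ?Q"
        by (rule CollectI, rule exI[of _ 0], rule exI[of _ 0]) (simp add: mono_span_def poly_ring_zero)
    next
      fix y z assume "y \<in> ?Q" "z \<in> ?Q"
      then obtain j f j' f' where "y = j + f * ?u" "j \<in> mono_span A" "f \<in> carrier (poly_ring X)"
        "z = j' + f' * ?u" "j' \<in> mono_span A" "f' \<in> carrier (poly_ring X)" by blast
      then show "y + z \<in> ?Q"
        by (intro CollectI exI[of _ "j + j'"] exI[of _ "f + f'"])
          (simp add: algebra_simps mono_span_add poly_ring_add)
    next
      fix a and c :: 'k assume "a \<in> A \<union> (\<lambda>m. m + b) ` monomials X"
      then show "Poly_Mapping.single a c \<in> ?Q"
      proof
        assume "a \<in> A"
        then show ?thesis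
          by (intro CollectI exI[of _ "Poly_Mapping.single a c"] exI[of _ 0])
            (simp add: mono_span_single poly_ring_zero)
      next
        assume "a \<in> (\<lambda>m. m + b) ` monomials X"
        then obtain m where "m \<in> monomials X" "a = m + b" by blast
        then show ?thesis
          by (intro CollectI exI[of _ 0] exI[of _ "Poly_Mapping.single m c"])
            (simp add: carrier_poly_ring mono_span_single mult_single, simp add: mono_span_def)
      qed
    qed
  qed
  with ext show ?thesis by simp
qed

lemma mono_span_empty: "mono_span {} = {0}"
  by (auto simp: mono_span_def)

text \<open>A new variable \<open>y\<close> is a nonzerodivisor modulo the ideal of the variables in
  \<open>Y\<close>, so the colon by \<open>y\<close> is that ideal itself. The induction hypothesis
  thus resolves both the old ideal and the colon, in the manner of the Koszul complex.\<close>

lemma linear_res_ideal_vars: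
  assumes "finite Y" "Y \<subseteq> X"
  shows "linear_res_ideal X 1
    (mono_span {m \<in> monomials X. \<exists>y\<in>Y. Poly_Mapping.lookup m y > 0} :: ('v, 'k::field) mpoly set)"
  using assms
proof (induction Y)
  case empty
  then show ?case by (simp add: mono_span_empty linear_res_ideal_0)
next
  case (insert y Y)
  let ?A = "{m \<in> monomials X. \<exists>y\<in>Y. Poly_Mapping.lookup m y > 0}"
  let ?b = "Poly_Mapping.single y (1 :: nat)"
  have b: "?b \<in> monomials X" using insert.prems by (simp add: monomials_single)
  have "{m \<in> monomials X. m + ?b \<in> ?A} = ?A"
    using insert.hyps b by (auto simp: lookup_add lookup_single when_def monomials_add)
  moreover have "?A \<union> (\<lambda>m. m + ?b) ` monomials X =
    {m \<in> monomials X. \<exists>y\<in>insert y Y. Poly_Mapping.lookup m y > 0}"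
  proof -
    have "m \<in> (\<lambda>m. m + ?b) ` monomials X" if "m \<in> monomials X" "Poly_Mapping.lookup m y > 0" for m
    proof (rule image_eqI)
      show "m = (m - ?b) + ?b"
        using that(2) by (intro mono_dvd_diff_add[symmetric])
        (auto simp: mono_dvd_def lookup_single when_def)
      show "m - ?b \<in> monomials X" using that(1) by (rule monomials_diff)
    qed
    then show ?thesis using b by (auto simp: monomials_add lookup_add)
  qed
  moreover have "mono_upclosed X ?A"
    by (auto simp: mono_upclosed_def monomials_add lookup_add)
  ultimately show ?case
    using linear_res_ideal_mono_insert[of X ?A 1 ?b, where 'k = 'k] insert b by simp
qed

text \<open>The exchange condition says that each colon ideal by the generators
  preceding \<open>a\<close> is generated by variables.\<close>

lemma linear_res_ideal_linear_quotients:
  assumes "finite P" "finite X" "P \<subseteq> monomials X" "\<And>a. a \<in> P \<Longrightarrow> mdeg a = d"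
    and "transp_on P prec" "asymp_on P prec" "totalp_on P prec"
    and "\<And>a b. a \<in> P \<Longrightarrow> b \<in> P \<Longrightarrow> prec b a \<Longrightarrow> \<exists>c\<in>P. \<exists>j\<in>X. prec c a \<and>
      Poly_Mapping.lookup a j < Poly_Mapping.lookup b j \<and> mono_dvd c (Poly_Mapping.single j 1 + a)"
  shows "linear_res_ideal X d (mono_span (mono_multiples X P) :: ('v, 'k::field) mpoly set)"
  using assms
proof (induction "card P" arbitrary: P)
  case 0
  then show ?case by (simp add: mono_multiples_def mono_span_empty linear_res_ideal_0)
next
  case (Suc n)
  then have "P \<noteq> {}" by auto
  from Finite_Set.bex_max_element[OF Suc.prems(1,6,5) this]
  obtain a where a: "a \<in> P" "\<And>b. b \<in> P \<Longrightarrow> b \<noteq> a \<Longrightarrow> \<not> prec a b" by blast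
  have prec_a: "prec b a" if "b \<in> P - {a}" for b
    using that a totalp_onD[OF Suc.prems(7)] by blast
  let ?Q = "P - {a}"
  let ?A = "mono_multiples X ?Q"
  have ax: "a \<in> monomials X" using a Suc.prems(3) by blast
  have irrefl: "\<not> prec a a" using asymp_onD[OF Suc.prems(6) a(1) a(1)] by blast
  have IH: "linear_res_ideal X d (mono_span ?A :: ('v, 'k) mpoly set)"
  proof (rule Suc.hyps(1))
    show "n = card ?Q" using Suc.hyps(2) a(1) Suc.prems(1) by simp
    show "transp_on ?Q prec" "asymp_on ?Q prec" "totalp_on ?Q prec"
      using Suc.prems(5-7) by (auto intro: transp_on_subset asymp_on_subset totalp_on_subset)
    \<comment> \<open>The exchange condition survives the removal of \<open>a\<close>: the witness
      precedes \<open>x\<close>, whereas \<open>a\<close> is last and precedes nothing.\<close>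
    fix x b assume xb: "x \<in> ?Q" "b \<in> ?Q" "prec b x"
    then obtain c j where c: "c \<in> P" "j \<in> X" "prec c x"
      "Poly_Mapping.lookup x j < Poly_Mapping.lookup b j" "mono_dvd c (Poly_Mapping.single j 1 + x)"
      using Suc.prems(8)[of x b] by blast
    moreover have "c \<noteq> a" using c(3) a(2) xb(1) by blast
    ultimately show "\<exists>c\<in>?Q. \<exists>j\<in>X. prec c x \<and> Poly_Mapping.lookup x j < Poly_Mapping.lookup b j \<and>
      mono_dvd c (Poly_Mapping.single j 1 + x)" by blast
  qed (use Suc.prems in auto)
  \<comment> \<open>The variables in the colon ideal by \<open>a\<close>. The exchange condition
    says precisely that every monomial of the colon is divisible by one of them.\<close>
  define Y where "Y = {j \<in> X. \<exists>c\<in>?Q. mono_dvd c (Poly_Mapping.single j 1 + a)}"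
  have "m + a \<in> ?A \<longleftrightarrow> (\<exists>y\<in>Y. Poly_Mapping.lookup m y > 0)" if m: "m \<in> monomials X" for m
  proof
    assume "m + a \<in> ?A"
    then obtain b where b: "b \<in> ?Q" "mono_dvd b (m + a)" by (auto simp: mono_multiples_def)
    with Suc.prems(8)[of a b] a(1) prec_a obtain c j where c: "c \<in> P" "j \<in> X" "prec c a"
      "Poly_Mapping.lookup a j < Poly_Mapping.lookup b j" "mono_dvd c (Poly_Mapping.single j 1 + a)"
      by blast
    have "c \<noteq> a" using c(3) irrefl by blast
    with c have "j \<in> Y" by (auto simp: Y_def)
    moreover have "Poly_Mapping.lookup b j \<le> Poly_Mapping.lookup (m + a) j"
      using b(2) by (simp add: mono_dvd_def)
    then have "Poly_Mapping.lookup m j > 0" using c(4) by (simp add: lookup_add)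
    ultimately show "\<exists>y\<in>Y. Poly_Mapping.lookup m y > 0" by blast
  next
    assume "\<exists>y\<in>Y. Poly_Mapping.lookup m y > 0"
    then obtain y c where y: "Poly_Mapping.lookup m y > 0" "c \<in> ?Q"
      "mono_dvd c (Poly_Mapping.single y 1 + a)" by (auto simp: Y_def)
    have "Poly_Mapping.lookup c x \<le> Poly_Mapping.lookup (m + a) x" for x
    proof -
      have "Poly_Mapping.lookup c x \<le> (1 when y = x) + Poly_Mapping.lookup a x"
        using y(3) by (simp add: mono_dvd_def lookup_add lookup_single)
      with y(1) show ?thesis by (cases "y = x") (auto simp: lookup_add)
    qed
    with y(2) m ax show "m + a \<in> ?A"
      by (auto simp: mono_multiples_def mono_dvd_def monomials_add)
  qed
  then have colon: "{m \<in> monomials X. m + a \<in> ?A} =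
      {m \<in> monomials X. \<exists>y\<in>Y. Poly_Mapping.lookup m y > 0}" by blast
  have "finite Y" "Y \<subseteq> X" using Suc.prems(2) by (auto simp: Y_def)
  then have "linear_res_ideal X 1 (mono_span {m \<in> monomials X. m + a \<in> ?A} :: ('v, 'k) mpoly set)"
    unfolding colon by (rule linear_res_ideal_vars)
  note * = linear_res_ideal_mono_insert[OF mono_upclosed_multiples IH ax Suc.prems(4)[OF a(1)] this]
  have "m \<in> (\<lambda>m. m + a) ` monomials X" if "m \<in> monomials X" "mono_dvd a m" for m
    using mono_dvd_diff_add[OF that(2)] monomials_diff[OF that(1)] by (metis image_eqI)
  moreover have "mono_dvd a (m + a)" for m by (simp add: mono_dvd_def lookup_add)
  ultimately have "?A \<union> (\<lambda>m. m + a) ` monomials X = mono_multiples X P"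
    using a(1) ax by (auto simp: mono_multiples_def monomials_add)
  with * show ?case by simp
qed

section \<open>Degree slices of monomial ideals\<close>

lemma finite_monomials_mdeg:
  fixes X :: "'v set"
  assumes "finite X"
  shows "finite {m \<in> monomials X. mdeg m = d}"
proof (rule finite_subset)
  let ?F = "{f :: 'v \<Rightarrow> nat. \<forall>x. (x \<in> X \<longrightarrow> f x \<in> {..d}) \<and> (x \<notin> X \<longrightarrow> f x = 0)}"
  have "Poly_Mapping.lookup m \<in> ?F" if m: "m \<in> monomials X" "mdeg m = d" for m
  proof -
    have "Poly_Mapping.lookup m x \<le> d" if "x \<in> X" for x
      using m assms that mdeg_eq_sum[OF assms, of m] member_le_sum[of x X "Poly_Mapping.lookup m"]
      by (simp add: monomials_def)
    with m show ?thesis by (auto simp: monomials_def in_keys_iff)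
  qed
  then show "{m \<in> monomials X. mdeg m = d} \<subseteq> Poly_Mapping.lookup -` ?F" by auto
  show "finite (Poly_Mapping.lookup -` ?F)"
    using assms by (intro finite_vimageI finite_set_of_finite_funs)
      (auto intro!: injI simp: poly_mapping.lookup_inject)
qed

text \<open>Each monomial of a homogeneous element of degree \<open>l\<close> lies in
  \<open>A\<close> and has degree \<open>l\<close>, so the component ideal is generated by finitely
  many monomials of one degree when \<open>X\<close> is finite, the setting of linear
  quotients.\<close>

lemma genideal_homogeneous_component:
  fixes A :: "('v \<Rightarrow>\<^sub>0 nat) set"
  assumes "mono_upclosed X A"
  shows "Idl\<^bsub>poly_ring X\<^esub> {f \<in> mono_span A. homogeneous l f} =
    (mono_span (mono_multiples X {a \<in> A. mdeg a = l}) :: ('v, 'k::field) mpoly set)"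
proof (rule genideal_eq_mono_span[OF mono_upclosed_multiples])
  show "{f \<in> mono_span A. homogeneous l f} \<subseteq> mono_span (mono_multiples X {a \<in> A. mdeg a = l})"
    using assms mono_dvd_refl
    by (fastforce simp: mono_span_def homogeneous_def mono_multiples_def mono_upclosed_def)
  fix a assume "a \<in> mono_multiples X {a \<in> A. mdeg a = l}"
  then obtain b where "b \<in> A" "mdeg b = l" "mono_dvd b a" by (auto simp: mono_multiples_def)
  then show "\<exists>b. Poly_Mapping.single b 1 \<in> {f \<in> mono_span A :: ('v, 'k) mpoly set. homogeneous l f}
      \<and> mono_dvd b a"
    by (intro exI[of _ b]) (auto simp: mono_span_single homogeneous_def)
qed

lemma homogeneous_ideal_mono_span:
  assumes "mono_upclosed X A"
  shows "homogeneous_ideal X (mono_span A :: ('v, 'k::field) mpoly set)"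
proof -
  have "Idl\<^bsub>poly_ring X\<^esub> {f \<in> mono_span A. \<exists>d. homogeneous d f} = (mono_span A :: ('v, 'k) mpoly set)"
  proof (rule genideal_eq_mono_span[OF assms])
    fix a assume "a \<in> A"
    then show "\<exists>b. Poly_Mapping.single b 1 \<in> {f \<in> mono_span A :: ('v, 'k) mpoly set. \<exists>d. homogeneous d f}
        \<and> mono_dvd b a"
      by (intro exI[of _ a]) (auto simp: mono_span_single homogeneous_def mono_dvd_refl)
  qed auto
  with ideal_mono_span[OF assms] show ?thesis by (auto simp: homogeneous_ideal_def)
qed


section \<open>Symbolic powers of cover ideals\<close>

text \<open>A product of ideals is generated by the elementwise products \<open>?H\<close>. A
  monomial with total exponent at least \<open>Suc k\<close> on \<open>e\<close> has a variable in
  \<open>e\<close> that can be split off, and the quotient has total at least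
  \<open>k\<close>.\<close>

lemma power_ideal_vars:
  assumes e: "finite e" "e \<subseteq> X"
  shows "(Idl\<^bsub>poly_ring X\<^esub> (var ` e)) [^]\<^bsub>ideals_set (poly_ring X)\<^esub> k =
    (mono_span {m \<in> monomials X. (\<Sum>x\<in>e. Poly_Mapping.lookup m x) \<ge> k} :: ('v, 'k::field) mpoly set)"
proof (induction k)
  case 0
  then show ?case by (simp add: nat_pow_def ideals_set_def carrier_poly_ring)
next
  case (Suc k)
  interpret cring "poly_ring X :: ('v, 'k) mpoly ring" by (rule cring_poly_ring)
  let ?A = "\<lambda>k. {m \<in> monomials X. (\<Sum>x\<in>e. Poly_Mapping.lookup m x) \<ge> k}"
  have up: "mono_upclosed X (?A k)" for k
    by (auto simp: mono_upclosed_def monomials_add lookup_add sum.distrib)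
  have pos: "\<exists>x\<in>e. Poly_Mapping.lookup m x > 0" if "(\<Sum>x\<in>e. Poly_Mapping.lookup m x) \<ge> Suc k" for m k
    using that by (metis Suc_le_D gr0I sum.neutral nat.distinct(1))
  have one: "(\<Sum>x\<in>e. Poly_Mapping.lookup (Poly_Mapping.single y (1::nat)) x) = 1" if "y \<in> e" for y
    using that e(1) by (simp add: lookup_single when_def)
  have I1: "Idl\<^bsub>poly_ring X\<^esub> (var ` e) = (mono_span (?A 1) :: ('v, 'k) mpoly set)"
  proof (rule genideal_eq_mono_span[OF up])
    show "var ` e \<subseteq> (mono_span (?A 1) :: ('v, 'k) mpoly set)"
      using e one
      by (auto simp: var_def monomials_single simp del: One_nat_def intro!: mono_span_single)
    fix a assume "a \<in> ?A 1"
    then obtain x where "x \<in> e" "Poly_Mapping.lookup a x > 0" using pos[of 0 a] by auto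
    then show "\<exists>b. Poly_Mapping.single b 1 \<in> (var ` e :: ('v, 'k) mpoly set) \<and> mono_dvd b a"
      by (intro exI[of _ "Poly_Mapping.single x 1"])
        (auto simp: var_def mono_dvd_def lookup_single when_def)
  qed
  let ?H = "mono_span (?A k) <#>\<^bsub>poly_ring X\<^esub> mono_span (?A 1) :: ('v, 'k) mpoly set"
  have "(Idl\<^bsub>poly_ring X\<^esub> (var ` e)) [^]\<^bsub>ideals_set (poly_ring X)\<^esub> Suc k =
    (mono_span (?A k) \<cdot>\<^bsub>poly_ring X\<^esub> mono_span (?A 1) :: ('v, 'k) mpoly set)"
    using Suc.IH I1 by (simp add: nat_pow_def ideals_set_def)
  also have "\<dots> = Idl\<^bsub>poly_ring X\<^esub> ?H"
    using ideal_mono_span[OF up] by (intro ideal_prod_eq_genideal)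
  also have "\<dots> = mono_span (?A (Suc k))"
  proof (rule genideal_eq_mono_span[OF up])
    show "?H \<subseteq> mono_span (?A (Suc k))"
    proof
      fix z assume "z \<in> ?H"
      then obtain f g where z: "z = f * g" "f \<in> mono_span (?A k)" "g \<in> mono_span (?A 1)"
        by (auto simp: set_mult_def)
      have "m \<in> ?A (Suc k)" if m: "m \<in> Poly_Mapping.keys z" for m
      proof -
        obtain a b where "m = a + b" "a \<in> Poly_Mapping.keys f" "b \<in> Poly_Mapping.keys g"
          using keys_mult[of f g] m unfolding z(1) by blast
        with z(2,3) have "m = a + b" "a \<in> ?A k" "b \<in> ?A 1"
          unfolding mono_span_def by blast+
        then show ?thesis by (auto simp: lookup_add sum.distrib monomials_add)
      qed
      then show "z \<in> mono_span (?A (Suc k))" unfolding mono_span_def by blast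
    qed
    fix a assume a: "a \<in> ?A (Suc k)"
    then obtain x where x: "x \<in> e" "Poly_Mapping.lookup a x > 0" using pos by blast
    let ?x = "Poly_Mapping.single x (1 :: nat)"
    have eq: "a = (a - ?x) + ?x"
      using x(2) by (intro mono_dvd_diff_add[symmetric])
        (auto simp: mono_dvd_def lookup_single when_def)
    have "(\<Sum>y\<in>e. Poly_Mapping.lookup a y) = (\<Sum>y\<in>e. Poly_Mapping.lookup (a - ?x) y) + 1"
      by (subst eq) (simp add: lookup_add sum.distrib one[OF x(1), simplified])
    then have "a - ?x \<in> ?A k" using a by (auto intro: monomials_diff)
    moreover have "?x \<in> ?A 1" using x(1) e(2) one[OF x(1)]
      by (auto simp: monomials_single simp del: One_nat_def)
    ultimately have "Poly_Mapping.single (a - ?x) 1 * Poly_Mapping.single ?x 1 \<in> ?H"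
      by (auto simp: set_mult_def intro!: bexI mono_span_single)
    then have "Poly_Mapping.single a 1 \<in> ?H" using eq by (simp add: mult_single)
    then show "\<exists>b. Poly_Mapping.single b 1 \<in> ?H \<and> mono_dvd b a"
      using mono_dvd_refl by blast
  qed
  finally show ?case .
qed

text \<open>For a simple graph these are the k-covers known from vertex cover algebras: weights on
  the vertices with total at least \<open>k\<close> on every edge.\<close>

definition cover_exponents :: "'v set \<Rightarrow> 'v set set \<Rightarrow> nat \<Rightarrow> ('v \<Rightarrow>\<^sub>0 nat) set" where
  "cover_exponents X E k = {m \<in> monomials X. \<forall>e\<in>E. (\<Sum>x\<in>e. Poly_Mapping.lookup m x) \<ge> k}"

lemma mono_upclosed_cover_exponents: "mono_upclosed X (cover_exponents X E k)"
  by (auto simp: mono_upclosed_def cover_exponents_def monomials_add lookup_add sum.distrib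
    intro: trans_le_add2)

lemma cover_symbolic_power_eq_mono_span:
  assumes "simple_graph X E"
  shows "cover_symbolic_power X E k = (mono_span (cover_exponents X E k) :: ('v, 'k::field) mpoly set)"
proof -
  have "finite e" "e \<subseteq> X" if "e \<in> E" for e
    using assms that finite_subset by (auto simp: simple_graph_def)
  then have "cover_symbolic_power X E k = mono_span (monomials X) \<inter>
    (\<Inter>e\<in>E. (mono_span {m \<in> monomials X. (\<Sum>x\<in>e. Poly_Mapping.lookup m x) \<ge> k} :: ('v, 'k) mpoly set))"
    by (simp add: cover_symbolic_power_def carrier_poly_ring power_ideal_vars)
  then show ?thesis by (fastforce simp: mono_span_def cover_exponents_def)
qed

section \<open>The lexicographic order\<close>

text \<open>Variables of smaller \<open>rk\<close> are more significant, and the lexicographically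
  larger monomial comes first in the list of generators.\<close>

definition lex_before :: "('v \<Rightarrow> nat) \<Rightarrow> 'v set \<Rightarrow> ('v \<Rightarrow>\<^sub>0 nat) \<Rightarrow> ('v \<Rightarrow>\<^sub>0 nat) \<Rightarrow> bool" where
  "lex_before rk X b a \<longleftrightarrow> (\<exists>p\<in>X. Poly_Mapping.lookup a p < Poly_Mapping.lookup b p \<and>
     (\<forall>q\<in>X. rk q < rk p \<longrightarrow> Poly_Mapping.lookup a q = Poly_Mapping.lookup b q))"

lemma lex_before_trans:
  assumes rk: "inj_on rk X" and "lex_before rk X c b" "lex_before rk X b a"
  shows "lex_before rk X c a"
proof -
  from assms obtain p where p: "p \<in> X" "Poly_Mapping.lookup b p < Poly_Mapping.lookup c p"
     "\<forall>q\<in>X. rk q < rk p \<longrightarrow> Poly_Mapping.lookup b q = Poly_Mapping.lookup c q"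
    unfolding lex_before_def by blast
  from assms obtain r where r: "r \<in> X" "Poly_Mapping.lookup a r < Poly_Mapping.lookup b r"
     "\<forall>q\<in>X. rk q < rk r \<longrightarrow> Poly_Mapping.lookup a q = Poly_Mapping.lookup b q"
    unfolding lex_before_def by blast
  consider "rk p < rk r" | "rk r < rk p" | "p = r"
    using inj_onD[OF rk _ p(1) r(1)] by linarith
  then show ?thesis
  proof cases
    case 1
    with p r show ?thesis unfolding lex_before_def by (intro bexI[of _ p]) auto
  next
    case 2
    with p r show ?thesis unfolding lex_before_def by (intro bexI[of _ r]) auto
  next
    case 3
    with p r show ?thesis unfolding lex_before_def by (intro bexI[of _ r]) auto
  qed
qed

lemma lex_before_irrefl: "\<not> lex_before rk X a a"
  by (simp add: lex_before_def)

lemma lex_before_total: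
  assumes rk: "inj_on rk X" and "a \<in> monomials X" "b \<in> monomials X" "a \<noteq> b"
  shows "lex_before rk X a b \<or> lex_before rk X b a"
proof -
  obtain x where x: "Poly_Mapping.lookup a x \<noteq> Poly_Mapping.lookup b x"
    using \<open>a \<noteq> b\<close> poly_mapping_eqI[of a b] by blast
  have "x \<in> X"
  proof (rule ccontr)
    assume "x \<notin> X"
    then have "x \<notin> Poly_Mapping.keys a" "x \<notin> Poly_Mapping.keys b"
      using assms(2,3) by (auto simp: monomials_def)
    with x show False by (simp add: not_in_keys_iff_lookup_eq_zero)
  qed
  let ?D = "\<lambda>x. x \<in> X \<and> Poly_Mapping.lookup a x \<noteq> Poly_Mapping.lookup b x"
  obtain p where p: "?D p" "\<And>y. ?D y \<Longrightarrow> rk p \<le> rk y"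
    using ex_has_least_nat[of ?D x rk] x \<open>x \<in> X\<close> by metis
  then have eq: "Poly_Mapping.lookup a q = Poly_Mapping.lookup b q" if "q \<in> X" "rk q < rk p" for q
    using that leD by blast
  from p(1) consider "Poly_Mapping.lookup a p < Poly_Mapping.lookup b p"
    | "Poly_Mapping.lookup b p < Poly_Mapping.lookup a p" by linarith
  then show ?thesis
    unfolding lex_before_def using p(1) eq by cases (auto intro!: bexI[of _ p])
qed

lemma linear_res_ideal_lex:
  assumes "finite X" "inj_on rk X" "P \<subseteq> {m \<in> monomials X. mdeg m = d}"
    and "\<And>a b. a \<in> P \<Longrightarrow> b \<in> P \<Longrightarrow> lex_before rk X b a \<Longrightarrow> \<exists>c\<in>P. \<exists>j\<in>X. lex_before rk X c a \<and>
      Poly_Mapping.lookup a j < Poly_Mapping.lookup b j \<and> mono_dvd c (Poly_Mapping.single j 1 + a)"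
  shows "linear_res_ideal X d (mono_span (mono_multiples X P) :: ('v, 'k::field) mpoly set)"
proof (rule linear_res_ideal_linear_quotients[where prec = "lex_before rk X"])
  show "finite P"
    using finite_monomials_mdeg[OF assms(1)] assms(3) finite_subset by blast
  show "transp_on P (lex_before rk X)"
    using lex_before_trans[OF assms(2)] by (blast intro: transp_onI)
  show "asymp_on P (lex_before rk X)"
    using lex_before_trans[OF assms(2)] lex_before_irrefl by (blast intro: asymp_onI)
  show "totalp_on P (lex_before rk X)"
    using lex_before_total[OF assms(2)] assms(3) by (blast intro: totalp_onI)
qed (use assms in auto)


section \<open>Whiskered graphs\<close>

lemma whisker_rank_exists:
  assumes "finite V" "S \<subseteq> V"
  obtains rk :: "'v + 'v \<Rightarrow> nat" where "inj_on rk (whisker_verts V S)"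
    and "\<And>t s. t \<in> V - S \<Longrightarrow> s \<in> S \<Longrightarrow> rk (Inl t) < rk (Inl s)"
    and "\<And>v s. v \<in> V \<Longrightarrow> s \<in> S \<Longrightarrow> rk (Inl v) < rk (Inr s)"
proof -
  from finite_imp_inj_to_nat_seg[OF assms(1)] obtain f :: "'v \<Rightarrow> nat" and n
    where f: "f ` V = {i. i < n}" "inj_on f V" by blast
  have lt: "f v < n" if "v \<in> V" for v using f(1) that by blast
  \<comment> \<open>Three consecutive blocks of length \<open>n\<close>: V - S takes ranks below
    \<open>n\<close>, S those from \<open>n\<close>, and the whisker variables those from
    \<open>2 * n\<close>.\<close>
  define rk where "rk = case_sum (\<lambda>v. if v \<in> S then n + f v else f v) (\<lambda>s. 2 * n + f s)"
  show thesis
  proof (rule that[of rk])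
    show "inj_on rk (whisker_verts V S)"
    proof (rule inj_onI)
      fix x y assume "x \<in> whisker_verts V S" "y \<in> whisker_verts V S" "rk x = rk y"
      with assms(2) lt show "x = y"
        by (auto simp: whisker_verts_def rk_def split: if_splits dest: inj_onD[OF f(2)])
          (fastforce dest: inj_onD[OF f(2)] lt)+
    qed
  next
    fix t s assume "t \<in> V - S" "s \<in> S"
    with lt[of t] show "rk (Inl t) < rk (Inl s)" by (simp add: rk_def)
  next
    fix v s assume "v \<in> V" "s \<in> S"
    with lt[of v] show "rk (Inl v) < rk (Inr s)" by (simp add: rk_def)
  qed
qed

text \<open>A vertex of \<open>S\<close> is grouped with its whisker variable because the exchange
  argument compares two monomials on each whisker as a whole.\<close>

lemma mdeg_whisker:
  assumes "finite V" "S \<subseteq> V" "m \<in> monomials (whisker_verts V S)"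
  shows "mdeg m = (\<Sum>v\<in>V - S. Poly_Mapping.lookup m (Inl v)) +
    (\<Sum>s\<in>S. Poly_Mapping.lookup m (Inl s) + Poly_Mapping.lookup m (Inr s))"
proof -
  have fin: "finite S" using assms finite_subset by blast
  have "mdeg m = (\<Sum>x\<in>Inl ` V \<union> Inr ` S. Poly_Mapping.lookup m x)"
    using assms fin by (intro mdeg_eq_sum) (auto simp: monomials_def whisker_verts_def)
  also have "\<dots> = (\<Sum>x\<in>Inl ` V. Poly_Mapping.lookup m x) + (\<Sum>x\<in>Inr ` S. Poly_Mapping.lookup m x)"
    using assms fin by (intro sum.union_disjoint) auto
  also have "\<dots> = (\<Sum>v\<in>V. Poly_Mapping.lookup m (Inl v)) + (\<Sum>s\<in>S. Poly_Mapping.lookup m (Inr s))"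
    by (simp add: sum.reindex)
  also have "(\<Sum>v\<in>V. Poly_Mapping.lookup m (Inl v)) =
    (\<Sum>v\<in>V - S. Poly_Mapping.lookup m (Inl v)) + (\<Sum>s\<in>S. Poly_Mapping.lookup m (Inl s))"
    by (rule sum.subset_diff[OF assms(2) assms(1)])
  finally show ?thesis by (simp add: sum.distrib)
qed

lemma cover_exponents_whisker_iff:
  assumes "simple_graph V E"
  shows "m \<in> cover_exponents X (whisker_edges E S) k \<longleftrightarrow> m \<in> monomials X \<and>
    (\<forall>u v. {u, v} \<in> E \<longrightarrow> Poly_Mapping.lookup m (Inl u) + Poly_Mapping.lookup m (Inl v) \<ge> k) \<and>
    (\<forall>s\<in>S. Poly_Mapping.lookup m (Inl s) + Poly_Mapping.lookup m (Inr s) \<ge> k)"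
proof -
  have ne: "u \<noteq> v" if "{u, v} \<in> E" for u v
    using assms that by (auto simp: simple_graph_def)
  have ex: "\<exists>u v. e = {u, v}" if "e \<in> E" for e
    using assms that by (meson card_2_iff simple_graph_def)
  have "(\<forall>e\<in>E. (\<Sum>x\<in>Inl ` e. Poly_Mapping.lookup m x) \<ge> k) \<longleftrightarrow>
    (\<forall>u v. {u, v} \<in> E \<longrightarrow> Poly_Mapping.lookup m (Inl u) + Poly_Mapping.lookup m (Inl v) \<ge> k)"
    (is "?l \<longleftrightarrow> ?r")
  proof
    assume ?l
    show ?r
    proof (intro allI impI)
      fix u v assume "{u, v} \<in> E"
      with \<open>?l\<close> ne[of u v] show "Poly_Mapping.lookup m (Inl u) + Poly_Mapping.lookup m (Inl v) \<ge> k"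
        by (auto dest!: bspec[of _ _ "{u, v}"])
    qed
  next
    assume ?r
    show ?l
    proof
      fix e assume "e \<in> E"
      with ex obtain u v where "e = {u, v}" by blast
      with \<open>?r\<close> ne \<open>e \<in> E\<close> show "(\<Sum>x\<in>Inl ` e. Poly_Mapping.lookup m x) \<ge> k" by simp
    qed
  qed
  moreover have "whisker_edges E S = image Inl ` E \<union> (\<lambda>s. {Inl s, Inr s}) ` S"
    by (auto simp: whisker_edges_def)
  ultimately show ?thesis
    by (simp add: cover_exponents_def ball_Un)
qed

text \<open>This is x_j a / x_i. Adding before subtracting makes the truncated subtraction exact as
  soon as x_i divides x_j a, also when i and j coincide.\<close>

definition shift_unit :: "'v \<Rightarrow> 'v \<Rightarrow> ('v \<Rightarrow>\<^sub>0 nat) \<Rightarrow> ('v \<Rightarrow>\<^sub>0 nat)" where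
  "shift_unit i j a = Poly_Mapping.single j 1 + a - Poly_Mapping.single i 1"

lemma lookup_shift_unit:
  "Poly_Mapping.lookup (shift_unit i j a) x =
    (if x = j then 1 else 0) + Poly_Mapping.lookup a x - (if x = i then 1 else 0)"
  by (auto simp: shift_unit_def lookup_minus lookup_add lookup_single when_def)

lemma mdeg_shift_unit:
  assumes "Poly_Mapping.lookup a i > 0"
  shows "mdeg (shift_unit i j a) = mdeg a"
proof -
  have "shift_unit i j a + Poly_Mapping.single i 1 = Poly_Mapping.single j 1 + a"
    unfolding shift_unit_def using assms
    by (intro mono_dvd_diff_add) (auto simp: mono_dvd_def lookup_add lookup_single when_def)
  from arg_cong[OF this, of mdeg] show ?thesis by (simp add: mdeg_add)
qed

lemma shift_unit_exchange:
  assumes "rk j < rk i" "i \<in> X" "j \<in> X" "a \<in> monomials X" "Poly_Mapping.lookup a i > 0"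
  shows "shift_unit i j a \<in> monomials X" "lex_before rk X (shift_unit i j a) a"
    "mono_dvd (shift_unit i j a) (Poly_Mapping.single j 1 + a)"
  using assms unfolding lex_before_def
  by (auto simp: shift_unit_def intro!: monomials_diff monomials_add monomials_single)
    (auto simp: mono_dvd_def lookup_minus lookup_add lookup_single when_def intro!: bexI[of _ j])

text \<open>The variables in \<open>V - S\<close> come first and the whisker variables last. If no exchange is
  possible, then on each whisker \<open>b\<close> has at least the total exponent of \<open>a\<close>, hence the total
  exponent of \<open>b\<close> on \<open>V - S\<close> is at most that of \<open>a\<close>. A variable \<open>i\<close> of \<open>V - S\<close> at which \<open>b\<close> is
  smaller than \<open>a\<close> is blocked by an edge \<open>{i, w}\<close> with \<open>w \<in> V - S\<close>, so that \<open>V - S = {p, i, w}\<close>,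
  and the constraint at \<open>{i, w}\<close> makes the total of \<open>b\<close> too large.\<close>

lemma whisker_exchange:
  assumes G: "simple_graph V E" and S: "S \<subseteq> V" "card (V - S) \<le> 3"
    and rk: "\<And>t s. t \<in> V - S \<Longrightarrow> s \<in> S \<Longrightarrow> rk (Inl t) < rk (Inl s)"
      "\<And>v s. v \<in> V \<Longrightarrow> s \<in> S \<Longrightarrow> rk (Inl v) < rk (Inr s)"
      "inj_on rk (whisker_verts V S)"
    and ab: "a \<in> cover_exponents (whisker_verts V S) (whisker_edges E S) k"
      "b \<in> cover_exponents (whisker_verts V S) (whisker_edges E S) k"
      "mdeg a = mdeg b" "lex_before rk (whisker_verts V S) b a"
  shows "\<exists>i\<in>whisker_verts V S. \<exists>j\<in>whisker_verts V S. rk j < rk i \<and>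
    Poly_Mapping.lookup a i > 0 \<and> Poly_Mapping.lookup a j < Poly_Mapping.lookup b j \<and>
    shift_unit i j a \<in> cover_exponents (whisker_verts V S) (whisker_edges E S) k"
proof (rule ccontr)
  let ?X = "whisker_verts V S"
  let ?P = "cover_exponents ?X (whisker_edges E S) k"
  assume "\<not> ?thesis"
  then have infeasible: False if "i \<in> ?X" "j \<in> ?X" "rk j < rk i" "Poly_Mapping.lookup a i > 0"
    "Poly_Mapping.lookup a j < Poly_Mapping.lookup b j" "shift_unit i j a \<in> ?P" for i j
    using that by blast
  have fin: "finite V" using G by (simp add: simple_graph_def)
  define al where "al v = Poly_Mapping.lookup a (Inl v)" for v
  define ar where "ar v = Poly_Mapping.lookup a (Inr v)" for v
  define bl where "bl v = Poly_Mapping.lookup b (Inl v)" for v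
  define br where "br v = Poly_Mapping.lookup b (Inr v)" for v
  note defs = al_def ar_def bl_def br_def
  note P_iff = cover_exponents_whisker_iff[OF G]
  have am: "a \<in> monomials ?X" and bm: "b \<in> monomials ?X"
    using ab(1,2) by (simp_all add: P_iff)
  have aE: "al u + al v \<ge> k" and bE: "bl u + bl v \<ge> k" if "{u, v} \<in> E" for u v
    using ab(1,2) that by (simp_all add: P_iff defs)
  have aS: "al s + ar s \<ge> k" and bS: "bl s + br s \<ge> k" if "s \<in> S" for s
    using ab(1,2) that by (simp_all add: P_iff defs)
  have EV: "u \<in> V" "v \<in> V" "u \<noteq> v" if "{u, v} \<in> E" for u v
    using G that by (auto simp: simple_graph_def)
  have X: "Inl v \<in> ?X \<longleftrightarrow> v \<in> V" "Inr v \<in> ?X \<longleftrightarrow> v \<in> S" for v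
    by (auto simp: whisker_verts_def)
  have SV: "s \<in> V" if "s \<in> S" for s using S that by blast
  obtain p where p: "p \<in> ?X" "Poly_Mapping.lookup a p < Poly_Mapping.lookup b p"
     "\<And>q. q \<in> ?X \<Longrightarrow> rk q < rk p \<Longrightarrow> Poly_Mapping.lookup a q = Poly_Mapping.lookup b q"
    using ab(4) unfolding lex_before_def by blast
  \<comment> \<open>Before \<open>p\<close> the two monomials agree and at \<open>p\<close> the
    larger exponent is that of \<open>b\<close>, so \<open>b\<close> can fall behind only after
    \<open>p\<close>.\<close>
  have later: "rk p < rk q" if "q \<in> ?X" "Poly_Mapping.lookup b q < Poly_Mapping.lookup a q" for q
  proof -
    have "q \<noteq> p" using that p by auto
    then have "rk q \<noteq> rk p" using inj_onD[OF rk(3) _ that(1) p(1)] by blast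
    with that p(3)[OF that(1)] show ?thesis by fastforce
  qed
  \<comment> \<open>Lowering \<open>i\<close> endangers only tight constraints through
    \<open>i\<close>, and an edge whose other end is \<open>j\<close> is compensated. The hypothesis
    \<open>left\<close> makes no such exception because a whisker variable has larger rank than its
    vertex, so \<open>j\<close> cannot be the whisker variable of \<open>i\<close>.\<close>
  have no: False if ij: "i \<in> ?X" "j \<in> ?X" "rk j < rk i" "Poly_Mapping.lookup a i > 0"
      "Poly_Mapping.lookup a j < Poly_Mapping.lookup b j"
    and edge: "\<And>u v. {u, v} \<in> E \<Longrightarrow> i = Inl u \<Longrightarrow> j \<noteq> Inl v \<Longrightarrow> al u + al v > k"
    and left: "\<And>s. s \<in> S \<Longrightarrow> i = Inl s \<Longrightarrow> al s + ar s > k"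
    and right: "\<And>s. s \<in> S \<Longrightarrow> i = Inr s \<Longrightarrow> j \<noteq> Inl s \<Longrightarrow> al s + ar s > k" for i j
  proof (rule infeasible[OF ij])
    let ?c = "shift_unit i j a"
    have ge: "Poly_Mapping.lookup a x \<le> Poly_Mapping.lookup ?c x" if "x \<noteq> i" for x
      using that by (simp add: lookup_shift_unit)
    have cj: "Poly_Mapping.lookup ?c j = Suc (Poly_Mapping.lookup a j)"
      using ij(3) by (auto simp: lookup_shift_unit)
    have ci: "Poly_Mapping.lookup a i = Suc (Poly_Mapping.lookup ?c i)"
      using ij(3,4) by (auto simp: lookup_shift_unit)
    have one: "k \<le> Poly_Mapping.lookup ?c (Inl u) + Poly_Mapping.lookup ?c (Inl v)"
      if uv: "{u, v} \<in> E" "i = Inl u" for u v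
    proof (cases "j = Inl v")
      case True
      with aE[OF uv(1)] ci cj uv(2) show ?thesis by (simp add: defs)
    next
      case False
      with edge[OF uv] ci ge[of "Inl v"] EV(3)[OF uv(1)] uv(2) show ?thesis by (simp add: defs)
    qed
    have "k \<le> Poly_Mapping.lookup ?c (Inl u) + Poly_Mapping.lookup ?c (Inl v)"
      if uv: "{u, v} \<in> E" for u v
    proof -
      consider "i = Inl u" | "i = Inl v" | "Inl u \<noteq> i" "Inl v \<noteq> i" by blast
      then show ?thesis
      proof cases
        case 1
        with one uv show ?thesis by blast
      next
        case 2
        have "{v, u} \<in> E" using uv by (simp add: insert_commute)
        from one[OF this 2] show ?thesis by simp
      next
        case 3
        from ge[OF 3(1)] ge[OF 3(2)] aE[OF uv] show ?thesis by (simp add: defs)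
      qed
    qed
    moreover have "k \<le> Poly_Mapping.lookup ?c (Inl s) + Poly_Mapping.lookup ?c (Inr s)"
      if s: "s \<in> S" for s
    proof -
      consider "i = Inl s" | "i = Inr s" "j = Inl s" | "i = Inr s" "j \<noteq> Inl s"
        | "Inl s \<noteq> i" "Inr s \<noteq> i" by blast
      then show ?thesis
      proof cases
        case 1
        with left[OF s] ci ge[of "Inr s"] show ?thesis by (simp add: defs)
      next
        case 2
        with aS[OF s] ci cj show ?thesis by (simp add: defs)
      next
        case 3
        with right[OF s] ci ge[of "Inl s"] show ?thesis by (simp add: defs)
      next
        case 4
        from ge[OF 4(1)] ge[OF 4(2)] aS[OF s] show ?thesis by (simp add: defs)
      qed
    qed
    ultimately show "?c \<in> ?P"
      using shift_unit_exchange(1)[OF ij(3,1,2) am ij(4)] by (simp add: P_iff)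
  qed
  \<comment> \<open>Trading a whisker variable for its own vertex keeps the whisker total, so it is
    always admissible while \<open>ar s\<close> is positive.\<close>
  have own: "ar s = 0" if "s \<in> S" "al s < bl s" for s
    using no[of "Inr s" "Inl s"] that rk(2) X SV by (fastforce simp: defs)
  have pair: "al s + ar s \<le> bl s + br s" if s: "s \<in> S" for s
  proof (rule ccontr)
    assume lt: "\<not> ?thesis"
    then have gt: "al s + ar s > k" using bS[OF s] by linarith
    \<comment> \<open>The whisker has slack in \<open>a\<close>. If \<open>p\<close> comes before
      \<open>Inr s\<close>, moving weight from \<open>Inr s\<close> to \<open>p\<close> is
      admissible, so \<open>ar s = 0\<close>; then \<open>al s\<close> alone exceeds
      \<open>k\<close>, no constraint at \<open>s\<close> is tight, and weight can move from
      \<open>Inl s\<close> to \<open>p\<close>. Otherwise \<open>p\<close> is at or after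
      \<open>Inr s\<close>, and \<open>a\<close> cannot be ahead of \<open>b\<close> on this
      whisker.\<close>
    show False
    proof (cases "rk p < rk (Inr s)")
      case True
      have "ar s = 0"
        using no[of "Inr s" p] True gt s p(1,2) X by (fastforce simp: defs)
      with lt have bl: "bl s < al s" by linarith
      have "rk p < rk (Inl s)" using later[of "Inl s"] X SV[OF s] bl by (auto simp: defs)
      moreover have "al s + al u > k" for u using gt \<open>ar s = 0\<close> by linarith
      ultimately show False
        using no[of "Inl s" p] gt s bl p(1,2) X SV[OF s] by (auto simp: al_def bl_def)
    next
      case False
      have "rk (Inl s) < rk p" using False rk(2)[OF SV[OF s] s] by linarith
      then have "al s = bl s" using p(3)[of "Inl s"] X SV[OF s] by (simp add: defs)
      moreover have "ar s \<le> br s" using later[of "Inr s"] False s X by (fastforce simp: defs)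
      ultimately show False using lt by linarith
    qed
  qed
  have sums: "(\<Sum>v\<in>V - S. al v) + (\<Sum>s\<in>S. al s + ar s) = (\<Sum>v\<in>V - S. bl v) + (\<Sum>s\<in>S. bl s + br s)"
    using ab(3) mdeg_whisker[OF fin S(1) am] mdeg_whisker[OF fin S(1) bm] by (simp add: defs)
  have finS: "finite S" using fin S finite_subset by blast
  have "(\<Sum>s\<in>S. al s + ar s) \<le> (\<Sum>s\<in>S. bl s + br s)"
    using pair by (rule sum_mono)
  with sums have T_le: "(\<Sum>v\<in>V - S. bl v) \<le> (\<Sum>v\<in>V - S. al v)" by linarith
  \<comment> \<open>If \<open>p\<close> belonged to a whisker, \<open>a\<close> and \<open>b\<close>
    would agree on V - S. Equal degrees would then turn all the inequalities \<open>pair\<close>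
    into equalities, which is impossible on the whisker containing \<open>p\<close>.\<close>
  have pT: "\<exists>t\<in>V - S. p = Inl t"
  proof (rule ccontr)
    assume n: "\<not> ?thesis"
    then consider s where "s \<in> S" "p = Inl s" | s where "s \<in> S" "p = Inr s"
      using p(1) by (auto simp: whisker_verts_def)
    then obtain s where s: "s \<in> S" "p = Inl s \<or> p = Inr s" by blast
    have "al t = bl t" if "t \<in> V - S" for t
    proof -
      have "rk (Inl t) < rk p" using rk(1)[OF that s(1)] rk(2)[of t s] that s by auto
      then show ?thesis using p(3)[of "Inl t"] that X by (simp add: defs)
    qed
    then have "(\<Sum>s\<in>S. al s + ar s) = (\<Sum>s\<in>S. bl s + br s)" using sums by simp
    then have eq: "al s + ar s = bl s + br s"
      by (rule sum_mono_inv[OF _ pair s(1) finS])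
    show False
    proof (cases "p = Inl s")
      case True
      then have "al s < bl s" using p(2) by (simp add: defs)
      then show False using own[OF s(1)] eq by linarith
    next
      case False
      then have pr: "p = Inr s" using s by blast
      then have "al s = bl s" using p(3)[of "Inl s"] rk(2)[OF SV s(1)] s(1) X SV by (simp add: defs)
      with eq p(2) pr show False by (simp add: defs)
    qed
  qed
  then obtain t where t: "t \<in> V - S" "p = Inl t" by blast
  have "al t < bl t" using p(2) t by (simp add: defs)
  have "\<exists>i\<in>V - S. bl i < al i"
  proof (rule ccontr)
    assume "\<not> ?thesis"
    then have "(\<Sum>v\<in>V - S. al v) < (\<Sum>v\<in>V - S. bl v)"
      using fin t(1) \<open>al t < bl t\<close> by (intro sum_strict_mono_ex1) (auto simp: not_less)
    with T_le show False by linarith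
  qed
  then obtain i where i: "i \<in> V - S" "bl i < al i" by blast
  have rk_i: "rk p < rk (Inl i)" using later[of "Inl i"] i X by (auto simp: defs)
  \<comment> \<open>Moving weight from \<open>i\<close> to \<open>t\<close> must be blocked, and
    since \<open>i\<close> carries no whisker the obstruction is a tight edge at \<open>i\<close>
    whose other end is not \<open>t\<close>.\<close>
  have "\<exists>w. {i, w} \<in> E \<and> w \<noteq> t \<and> al i + al w = k"
  proof (rule ccontr)
    assume "\<not> ?thesis"
    then have "al i + al w > k" if "{i, w} \<in> E" "w \<noteq> t" for w
      using aE[OF that(1)] that by fastforce
    then show False
      using no[of "Inl i" p] rk_i i p(1,2) t(2) X by (auto simp: defs)
  qed
  then obtain w where w: "{i, w} \<in> E" "w \<noteq> t" "al i + al w = k" by blast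
  have "bl i + bl w \<ge> k" using bE[OF w(1)] .
  with w(3) i(2) have bw: "al w < bl w" by linarith
  \<comment> \<open>On a vertex of \<open>S\<close> where \<open>b\<close> is ahead,
    \<open>own\<close> leaves the whole whisker weight of \<open>a\<close>, at least
    \<open>k\<close>, on the vertex. The tight edge would then leave nothing for \<open>i\<close>,
    yet \<open>al i\<close> is positive.\<close>
  have "w \<notin> S"
  proof
    assume "w \<in> S"
    then have "al w \<ge> k" using own[of w] bw aS[of w] by simp
    with w(3) i(2) show False by linarith
  qed
  then have sub: "{t, i, w} \<subseteq> V - S" using t i EV[OF w(1)] by blast
  have "i \<noteq> t" using i \<open>al t < bl t\<close> by auto
  then have card: "card {t, i, w} = 3" using w(2) EV(3)[OF w(1)] by auto
  have VS: "V - S = {t, i, w}" using sub card S(2) fin by (intro card_seteq[symmetric]) simp_all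
  have "(\<Sum>v\<in>V - S. al v) = al t + k" "(\<Sum>v\<in>V - S. bl v) \<ge> bl t + k"
    unfolding VS using \<open>i \<noteq> t\<close> w EV(3)[OF w(1)] \<open>bl i + bl w \<ge> k\<close> by auto
  with T_le \<open>al t < bl t\<close> show False by linarith
qed

theorem corollary4p8:
  fixes V S :: "'v set" and E :: "'v set set" and k :: nat
  assumes "simple_graph V E"
    and "S \<subseteq> V"
    and "int (card S) \<ge> int (card V) - 3"
    and "k \<ge> 1"
  shows "componentwise_linear (whisker_verts V S)
    (cover_symbolic_power (whisker_verts V S) (whisker_edges E S) k :: ('v + 'v, 'k::field) mpoly set)"
proof -
  let ?X = "whisker_verts V S"
  let ?A = "cover_exponents ?X (whisker_edges E S) k"
  have fin: "finite V" "finite S" "finite ?X"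
    using assms(1,2) finite_subset by (auto simp: simple_graph_def whisker_verts_def)
  have card: "card (V - S) \<le> 3"
    using assms(2,3) fin by (simp add: card_Diff_subset)
  obtain rk :: "'v + 'v \<Rightarrow> nat" where rk: "inj_on rk ?X"
    "\<And>t s. t \<in> V - S \<Longrightarrow> s \<in> S \<Longrightarrow> rk (Inl t) < rk (Inl s)"
    "\<And>v s. v \<in> V \<Longrightarrow> s \<in> S \<Longrightarrow> rk (Inl v) < rk (Inr s)"
    using whisker_rank_exists[OF fin(1) assms(2)] by blast
  have "linear_res_ideal ?X l (mono_span (mono_multiples ?X {a \<in> ?A. mdeg a = l})
    :: ('v + 'v, 'k) mpoly set)" for l
  proof (rule linear_res_ideal_lex[OF fin(3) rk(1)])
    show "{a \<in> ?A. mdeg a = l} \<subseteq> {m \<in> monomials ?X. mdeg m = l}"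
      by (auto simp: cover_exponents_def)
  next
    fix a b assume ab: "a \<in> {a \<in> ?A. mdeg a = l}" "b \<in> {a \<in> ?A. mdeg a = l}" "lex_before rk ?X b a"
    then obtain i j where ij: "i \<in> ?X" "j \<in> ?X" "rk j < rk i" "Poly_Mapping.lookup a i > 0"
      "Poly_Mapping.lookup a j < Poly_Mapping.lookup b j" "shift_unit i j a \<in> ?A"
      using whisker_exchange[OF assms(1,2) card rk(2,3,1), of a k b] by auto
    \<comment> \<open>The exchanged monomial has the same degree as \<open>a\<close>, so it stays
      among the generators of degree \<open>l\<close>, and it divides x_j a, as linear quotients
      require.\<close>
    have "a \<in> monomials ?X" using ab(1) by (simp add: cover_exponents_def)
    note ex = shift_unit_exchange[OF ij(3,1,2) this ij(4)]
    show "\<exists>c\<in>{a \<in> ?A. mdeg a = l}. \<exists>j\<in>?X. lex_before rk ?X c a \<and>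
      Poly_Mapping.lookup a j < Poly_Mapping.lookup b j \<and> mono_dvd c (Poly_Mapping.single j 1 + a)"
      using ij ex ab(1) mdeg_shift_unit[OF ij(4)]
      by (intro bexI[of _ "shift_unit i j a"] bexI[of _ j]) auto
  qed
  then show ?thesis
    unfolding componentwise_linear_def
      cover_symbolic_power_eq_mono_span[OF simple_graph_whisker[OF assms(1,2)]]
      genideal_homogeneous_component[OF mono_upclosed_cover_exponents]
    by (blast intro: homogeneous_ideal_mono_span mono_upclosed_cover_exponents
      has_linear_resolution_if_linear_res_ideal)
qed

end
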